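(* Let $X$ be a transient Borel right process satisfying the assumptions in the context, and let $\mu$ be its loop measure. Then $\mu$ is invariant under the loop rotation $\rho_v$ for any $v\ge 0$; that is, $\mu(F\circ\rho_v)=\mu(F)$ for every nonnegative measurable function $F$ on $\Omega$.
   Context: Setting. $S$ is a locally compact space with countable base, and $X=(\Omega,\mathcal{F}_t,X_t,\theta_t,P^x)$ is a transient Borel right process with state space $S$ and transition semigroup $(P_t)_{t\ge 0}$. It is in canonical form: $\Omega$ is the set of right continuous paths $\omega:[0,\infty)\to S_\Delta=S\cup\{\Delta\}$, $\Delta\notin S$, such that $\omega(t)=\Delta$ for all $t\ge\zeta(\omega)=\inf\{t>0:\omega(t)=\Delta\}$, and $X_t(\omega)=\omega(t)$. Functions on $S$ are extended by $0$ at $\Delta$. $\Omega$ carries the $\sigma$-algebra $\mathcal F$ of the process. $m$ is a Borel measure on $S$, finite on compact sets. No transition densities are assumed, but $X$ has strictly positive potential densities $u^\alpha(x,y)$, $\alpha\ge 0$, with respect to $m$: $\int_0^\infty e^{-\alpha t}P_t(x,dy)\,dt=u^\alpha(x,y)\,m(dy)$, and these satisfy the resolvent equations $u^\alpha(x,y)=u^\beta(x,y)+(\beta-\alpha)\int u^\alpha(x,z)u^\beta(z,y)\,dm(z)=u^\beta(x,y)+(\beta-\alpha)\int u^\beta(x,z)u^\alpha(z,y)\,dm(z)$ for $0\le\alpha\le\beta$. Write $u=u^0$. It is assumed that $u(x,y)$ is excessive in $x$ for each fixed $y$, that $u(x,x)=\infty$ for all $x$ and $u(x,y)<\infty$ for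 $x\ne y$, and that all points of $S$ are polar. The following are also assumed. (i) For every compact $K\subseteq S$, $\sup_{x}\int_{K}(u(x,y)+u(y,x))^{2}\,dm(y)<\infty$. (ii) For any $\alpha>0$, any compact $K\subseteq S$, and any compact neighborhood $\widetilde K$ of $K$, $\sup_{z\in\widetilde K^{c},\,x\in K}u^{\alpha}(z,x)<\infty$. (iii) For any $\delta>0$ and any compact $K\subseteq S$, $\int_{S}\int_{K}P_{\delta}(z,dx)\,u(x,z)\,dm(z)<\infty$ (here $x$ ranges over $K$ and $z$ over $S$). The measures $Q^{z,z}$. Fix $z\in S$, put $h_z(x)=u(x,z)$, and on $S_z=S\setminus\{z\}$ let $P^z_t(x,dy)=P_t(x,dy)\,h_z(y)/h_z(x)$. The $\sigma$-finite measures $\eta^z_t(dx)=P_t(z,dx)h_z(x)$, $t>0$, form an entrance law for $(P^z_t)$. $Q^{z,z}$ is the measure on $\Omega$ (carried by paths with $X_0=z$ and $\zeta>0$) under which $(X_t)_{t>0}$ is the right process with one-dimensional distributions $\eta^z_t$ on $S$ and transition semigroup $(P^z_t)$. Thus for $0<t_1<\cdots<t_k$, with $t_0=0$, $x_0=z$, and nonnegative measurable $f_j$ on $S$, $$Q^{z,z}\Big(\prod_{j=1}^k f_j(X_{t_j})\Big)=\int\prod_{j=1}^kP_{t_j-t_{j-1}}(x_{j-1},dx_j)\prod_{j=1}^kf_j(x_j)\;u(x_k,z).$$ The loop measure is $\mu(F)=\int_S Q^{z,z}(F/\zeta)\,dm(z)$ for measurable $F$ on $\Omega$. Loop rotation.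 For $v\ge 0$ and $\omega$ with $0<\zeta(\omega)<\infty$, $\rho_v\omega(s)=\omega\big((s+v)\bmod\zeta(\omega)\big)$ if $0\le s<\zeta(\omega)$, and $\rho_v\omega(s)=\Delta$ otherwise. Here $a\bmod b=a-nb$ for the unique integer $n\ge 0$ with $0\le a-nb<b$. By convention $\rho_v\omega=\omega$ if $\zeta(\omega)\in\{0,\infty\}$. *)

theory Defs
  imports "HOL-Probability.Probability" "HOL-Library.Real_Mod"
begin

section \<open>Canonical path space\<close>

text \<open>
  The state space is a type \<open>'a\<close>, and its extension by the cemetery is \<open>'a option\<close> with
  \<open>None\<close> as the cemetery, added as an isolated point. If the cemetery were the point at infinity
  instead, the only change would be additional paths starting at the cemetery and having a positive
  lifetime; none of the measures below charges such paths.
\<close>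

definition ext0 :: "('a \<Rightarrow> ennreal) \<Rightarrow> 'a option \<Rightarrow> ennreal" where
  "ext0 f = case_option 0 f"

definition hitting_time :: "'a option set \<Rightarrow> (real \<Rightarrow> 'a option) \<Rightarrow> ennreal" where
  "hitting_time B \<omega> = (INF t\<in>{t. 0 < t \<and> \<omega> t \<in> B}. ennreal t)"

abbreviation lifetime :: "(real \<Rightarrow> 'a option) \<Rightarrow> ennreal" where
  "lifetime \<equiv> hitting_time {None}"

definition right_continuous_path :: "(real \<Rightarrow> 'a::topological_space option) \<Rightarrow> bool" where
  "right_continuous_path \<omega> \<longleftrightarrow>
     (\<forall>t\<ge>0. \<forall>U. open (Some -` U) \<and> \<omega> t \<in> U \<longrightarrow> (\<forall>\<^sub>F s in at_right t. \<omega> s \<in> U))"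

text \<open>A path is a function on \<open>[0,\<infinity>)\<close>; extensionality makes its values at negative times irrelevant.\<close>

definition path_space :: "(real \<Rightarrow> 'a::topological_space option) set" where
  "path_space = {\<omega> \<in> extensional {0..}. right_continuous_path \<omega> \<and>
                    (\<forall>t\<ge>0. lifetime \<omega> \<le> ennreal t \<longrightarrow> \<omega> t = None)}"

text \<open>The \<open>\<sigma>\<close>-algebra on path space is the one generated by the coordinates \<open>X\<^sub>t\<close>, \<open>t \<ge> 0\<close>.\<close>

definition path_algebra :: "(real \<Rightarrow> 'a::topological_space option) measure" where
  "path_algebra = sigma path_space
     {{\<omega> \<in> path_space. \<omega> t \<in> Some ` A} | t A. 0 \<le> t \<and> A \<in> sets borel}"


section \<open>Markov laws and Borel right processes\<close>

text \<open>
  \<open>chain_int T s x [(t\<^sub>1,f\<^sub>1),\<dots>,(t\<^sub>k,f\<^sub>k)]\<close> is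
  \<open>\<integral> T\<^bsub>t\<^sub>1-s\<^esub>(x,dx\<^sub>1) f\<^sub>1(x\<^sub>1) \<integral> T\<^bsub>t\<^sub>2-t\<^sub>1\<^esub>(x\<^sub>1,dx\<^sub>2) f\<^sub>2(x\<^sub>2) \<dots> f\<^sub>k(x\<^sub>k)\<close>.
\<close>

primrec chain_int ::
  "(real \<Rightarrow> 'a \<Rightarrow> 'a measure) \<Rightarrow> real \<Rightarrow> 'a \<Rightarrow> (real \<times> ('a \<Rightarrow> ennreal)) list \<Rightarrow> ennreal" where
  "chain_int T s x [] = 1"
| "chain_int T s x (p # ps) =
     (\<integral>\<^sup>+ y. snd p y * chain_int T (fst p) y ps \<partial>T (fst p - s) x)"

text \<open>
  Under \<open>M\<close>, the coordinate process indexed by the up-closed set of times \<open>I\<close> is Markov with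
  one-dimensional distributions \<open>\<eta> t\<close> on the state space and transition semigroup \<open>T\<close>.
\<close>

definition markov_law ::
  "(real \<Rightarrow> 'a::topological_space option) measure \<Rightarrow> real set \<Rightarrow> (real \<Rightarrow> 'a measure) \<Rightarrow>
   (real \<Rightarrow> 'a \<Rightarrow> 'a measure) \<Rightarrow> bool" where
  "markov_law M I \<eta> T \<longleftrightarrow>
     (\<forall>t f ps. t \<in> I \<and> sorted_wrt (<) (map fst ((t, f) # ps)) \<and>
               (\<forall>g \<in> snd ` set ((t, f) # ps). g \<in> borel_measurable borel) \<longrightarrow>
        (\<integral>\<^sup>+ \<omega>. (\<Prod>(s, g)\<leftarrow>(t, f) # ps. ext0 g (\<omega> s)) \<partial>M)
          = (\<integral>\<^sup>+ x. f x * chain_int T t x ps \<partial>\<eta> t))"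

definition borel_semigroup :: "(real \<Rightarrow> 'a::topological_space \<Rightarrow> 'a measure) \<Rightarrow> bool" where
  "borel_semigroup P \<longleftrightarrow>
     (\<forall>t\<ge>0. P t \<in> borel \<rightarrow>\<^sub>M subprob_algebra borel) \<and>
     (\<forall>x. P 0 x = return borel x) \<and>
     (\<forall>s\<ge>0. \<forall>t\<ge>0. \<forall>x. P (s + t) x = P s x \<bind> P t)"

definition alpha_excessive ::
  "(real \<Rightarrow> 'a::topological_space \<Rightarrow> 'a measure) \<Rightarrow> real \<Rightarrow> ('a \<Rightarrow> ennreal) \<Rightarrow> bool" where
  "alpha_excessive P \<alpha> f \<longleftrightarrow>
     f \<in> borel_measurable borel \<and>
     (\<forall>t\<ge>0. \<forall>x. ennreal (exp (- \<alpha> * t)) * (\<integral>\<^sup>+ y. f y \<partial>P t x) \<le> f x) \<and>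
     (\<forall>x. ((\<lambda>t. ennreal (exp (- \<alpha> * t)) * (\<integral>\<^sup>+ y. f y \<partial>P t x)) \<longlongrightarrow> f x) (at_right 0))"

abbreviation excessive :: "(real \<Rightarrow> 'a::topological_space \<Rightarrow> 'a measure) \<Rightarrow> ('a \<Rightarrow> ennreal) \<Rightarrow> bool" where
  "excessive P \<equiv> alpha_excessive P 0"

text \<open>
  A Borel right process in canonical form is given by its semigroup \<open>P\<close> and its laws \<open>Px x\<close>; the
  coordinate process, the shifts and the augmented natural filtration are then determined.
  Right continuity of the paths is part of \<^const>\<open>path_space\<close>. The last assumption is the second
  of the usual right hypotheses (it implies the strong Markov property).
\<close>

locale borel_right_process =
  fixes P :: "real \<Rightarrow> 'a::{second_countable_topology, t2_space} \<Rightarrow> 'a measure"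
    and Px :: "'a \<Rightarrow> (real \<Rightarrow> 'a option) measure"
  assumes state_space: "locally_compact_space (euclidean :: 'a topology)"
    and semigroup: "borel_semigroup P"
    and Px_prob: "\<And>x. prob_space (Px x)"
    and sets_Px: "\<And>x. sets (Px x) = sets path_algebra"
    and Px_start: "\<And>x. AE \<omega> in Px x. \<omega> 0 = Some x"
    and Px_markov: "\<And>x. markov_law (Px x) {0..} (\<lambda>t. P t x) P"
    and excessive_right_continuous:
      "\<And>\<alpha> f x. 0 < \<alpha> \<Longrightarrow> alpha_excessive P \<alpha> f \<Longrightarrow>
         AE \<omega> in Px x. \<forall>t\<ge>0. ((\<lambda>s. ext0 f (\<omega> s)) \<longlongrightarrow> ext0 f (\<omega> t)) (at_right t)"

definition transient :: "(real \<Rightarrow> 'a::topological_space \<Rightarrow> 'a measure) \<Rightarrow> bool" where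
  "transient P \<longleftrightarrow>
     (\<exists>g \<in> borel_measurable borel. (\<forall>x. (0::ennreal) < g x) \<and>
        (\<forall>x. (\<integral>\<^sup>+ t\<in>{0..}. (\<integral>\<^sup>+ y. g y \<partial>P t x) \<partial>lborel) < \<infinity>))"

definition polar :: "('a \<Rightarrow> (real \<Rightarrow> 'a option) measure) \<Rightarrow> 'a set \<Rightarrow> bool" where
  "polar Px A \<longleftrightarrow> (\<forall>x. AE \<omega> in Px x. hitting_time (Some ` A) \<omega> = \<infinity>)"


section \<open>Potential densities and standing assumptions\<close>

locale loop_setting = borel_right_process P Px
  for P :: "real \<Rightarrow> 'a::{second_countable_topology, t2_space} \<Rightarrow> 'a measure"
    and Px :: "'a \<Rightarrow> (real \<Rightarrow> 'a option) measure" +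
  fixes m :: "'a measure"
    and u :: "real \<Rightarrow> 'a \<Rightarrow> 'a \<Rightarrow> ennreal"
  assumes transient: "transient P"
    and sets_m: "sets m = sets borel"
    and m_compact: "\<And>K. compact K \<Longrightarrow> emeasure m K < \<infinity>"
    and u_measurable:
      "\<And>\<alpha>. 0 \<le> \<alpha> \<Longrightarrow> (\<lambda>(x, y). u \<alpha> x y) \<in> borel_measurable (borel \<Otimes>\<^sub>M borel)"
    and u_pos: "\<And>\<alpha> x y. 0 \<le> \<alpha> \<Longrightarrow> 0 < u \<alpha> x y"
    and u_density: "\<And>\<alpha> x A. 0 \<le> \<alpha> \<Longrightarrow> A \<in> sets borel \<Longrightarrow>
      (\<integral>\<^sup>+ t\<in>{0..}. ennreal (exp (- \<alpha> * t)) * emeasure (P t x) A \<partial>lborel)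
        = (\<integral>\<^sup>+ y\<in>A. u \<alpha> x y \<partial>m)"
    and resolvent1: "\<And>\<alpha> \<beta> x y. 0 \<le> \<alpha> \<Longrightarrow> \<alpha> \<le> \<beta> \<Longrightarrow>
      u \<alpha> x y = u \<beta> x y + ennreal (\<beta> - \<alpha>) * (\<integral>\<^sup>+ z. u \<alpha> x z * u \<beta> z y \<partial>m)"
    and resolvent2: "\<And>\<alpha> \<beta> x y. 0 \<le> \<alpha> \<Longrightarrow> \<alpha> \<le> \<beta> \<Longrightarrow>
      u \<alpha> x y = u \<beta> x y + ennreal (\<beta> - \<alpha>) * (\<integral>\<^sup>+ z. u \<beta> x z * u \<alpha> z y \<partial>m)"
    and u_excessive: "\<And>y. excessive P (\<lambda>x. u 0 x y)"
    and u_diagonal: "\<And>x. u 0 x x = \<infinity>"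
    and u_off_diagonal: "\<And>x y. x \<noteq> y \<Longrightarrow> u 0 x y < \<infinity>"
    and points_polar: "\<And>y. polar Px {y}"
    and u_square_integrable: "\<And>K. compact K \<Longrightarrow>
      (SUP x. \<integral>\<^sup>+ y\<in>K. (u 0 x y + u 0 y x)\<^sup>2 \<partial>m) < \<infinity>"
    and u_bounded_off: "\<And>\<alpha> K K'. 0 < \<alpha> \<Longrightarrow> compact K \<Longrightarrow> compact K' \<Longrightarrow> K \<subseteq> interior K' \<Longrightarrow>
      (SUP z\<in>- K'. SUP x\<in>K. u \<alpha> z x) < \<infinity>"
    and bridge_mass_finite: "\<And>\<delta> K. 0 < \<delta> \<Longrightarrow> compact K \<Longrightarrow>
      (\<integral>\<^sup>+ z. (\<integral>\<^sup>+ x\<in>K. u 0 x z \<partial>P \<delta> z) \<partial>m) < \<infinity>"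


section \<open>The measures \<open>Q\<^sup>z\<^sup>,\<^sup>z\<close>, the loop measure and loop rotation\<close>

text \<open>
  In the next two definitions \<open>h\<close> is \<open>h\<^sub>z = u(\<cdot>,z)\<close>. The \<open>h\<close>-transform is meaningful at
  \<open>x \<noteq> z\<close>, where \<open>0 < h x < \<infinity>\<close>; as points are polar, neither it nor the entrance law charges \<open>z\<close>.
\<close>

definition h_transform ::
  "('a \<Rightarrow> ennreal) \<Rightarrow> (real \<Rightarrow> 'a \<Rightarrow> 'a measure) \<Rightarrow> real \<Rightarrow> 'a \<Rightarrow> 'a measure" where
  "h_transform h P t x = density (P t x) (\<lambda>y. h y / h x)"

definition entrance_law ::
  "('a \<Rightarrow> ennreal) \<Rightarrow> (real \<Rightarrow> 'a \<Rightarrow> 'a measure) \<Rightarrow> 'a \<Rightarrow> real \<Rightarrow> 'a measure" where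
  "entrance_law h P z t = density (P t z) h"

text \<open>The following properties determine the measure \<open>Q\<^sup>z\<^sup>,\<^sup>z\<close>, which may be infinite, uniquely.\<close>

definition is_Qzz ::
  "(real \<Rightarrow> 'a::topological_space \<Rightarrow> 'a measure) \<Rightarrow> (real \<Rightarrow> 'a \<Rightarrow> 'a \<Rightarrow> ennreal) \<Rightarrow> 'a \<Rightarrow>
   (real \<Rightarrow> 'a option) measure \<Rightarrow> bool" where
  "is_Qzz P u z M \<longleftrightarrow>
     sets M = sets path_algebra \<and>
     (AE \<omega> in M. \<omega> 0 = Some z \<and> 0 < lifetime \<omega>) \<and>
     markov_law M {0<..} (entrance_law (\<lambda>x. u 0 x z) P z) (h_transform (\<lambda>x. u 0 x z) P)"

definition loop_measure ::
  "'a measure \<Rightarrow> ('a \<Rightarrow> (real \<Rightarrow> 'a option) measure) \<Rightarrow> ((real \<Rightarrow> 'a option) \<Rightarrow> ennreal) \<Rightarrow> ennreal" where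
  "loop_measure m Q F = (\<integral>\<^sup>+ z. (\<integral>\<^sup>+ \<omega>. F \<omega> / lifetime \<omega> \<partial>Q z) \<partial>m)"

definition loop_rotation :: "real \<Rightarrow> (real \<Rightarrow> 'a option) \<Rightarrow> real \<Rightarrow> 'a option" where
  "loop_rotation v \<omega> =
     (if 0 < lifetime \<omega> \<and> lifetime \<omega> < \<infinity>
      then (\<lambda>s\<in>{0..}. if ennreal s < lifetime \<omega>
                        then \<omega> ((s + v) rmod enn2real (lifetime \<omega>)) else None)
      else \<omega>)"

end

theory Submission
  imports Defs
begin

text \<open>
  Cut a loop \<open>\<omega>\<close> of lifetime \<open>\<zeta>\<close> at a time \<open>v\<close> with \<open>0 < v < \<zeta>\<close> into the arc before \<open>v\<close> and the arc after
  \<open>v\<close>. The theorem rests on a symmetry: under \<open>m(dz) Q\<^sup>z\<^sup>,\<^sup>z(d\<omega>) dv\<close> the two arcs are exchangeable.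
  Indeed, consider one event about the first arc and one about the second, each given by conditions at
  finitely many times. By the Markov property, the measure of both together contains the cutting time
  \<open>v\<close> only in the transition that leads from the last observation of the first arc to the cutting point
  \<open>y = \<omega>(v)\<close>. Integrating over \<open>v\<close> turns this transition into \<open>u(\<cdot>,y) m(dy)\<close>, and the result is
  \<open>\<integral>\<integral> a(z,y) b(y,z) m(dy) m(dz)\<close>, where \<open>a(x,y)\<close> and \<open>b(x,y)\<close> are the weights of the arcs from \<open>x\<close> to \<open>y\<close>
  that satisfy the first and the second set of conditions (\<open>pair_law_rectangle\<close>). Exchanging the arcs
  renames \<open>z\<close> and \<open>y\<close>. Since the cutting time is integrated out, the potential densities do what
  transition densities would do for loops of fixed length.

  Gluing the two arcs in their original order restores \<open>\<omega>\<close>, and in the opposite order it gives the rotated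
  loop \<open>\<rho>\<^sub>v \<omega>\<close> (\<open>loop_rotation_concat\<close>). Hence, for nonnegative \<open>H\<close> that vanish
  on paths of infinite lifetime, the measure \<open>m(dz) Q\<^sup>z\<^sup>,\<^sup>z(d\<omega>)\<close> gives the same integral to \<open>\<integral>\<^sub>0\<^sup>\<zeta> H(\<omega>) dv\<close> and to \<open>\<integral>\<^sub>0\<^sup>\<zeta> H(\<rho>\<^sub>v \<omega>) dv\<close> (\<open>rotation_average\<close>). With \<open>H = F / \<zeta>\<^sup>2\<close> the
  first one is \<open>\<mu>(F)\<close>, and the second one contains \<open>F\<close> only through its average over all rotations of the
  loop. This average is the same for \<open>F\<close> and for \<open>F \<circ> \<rho>\<^sub>w\<close>, since \<open>v \<mapsto> \<rho>\<^sub>v \<omega>\<close> is periodic with period \<open>\<zeta>\<close>;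
  so the invariance holds for each fixed rotation, and not merely for almost every one.

  The measure theory behind these formulas comes from the following facts. Right continuity makes the
  coordinates, and with them cutting, gluing and rotating, jointly measurable in time and path
  (\<open>measurable_evaluate\<close>); this also yields the measurability of \<open>P\<^sub>t(x,A)\<close> in \<open>(t,x)\<close>. Polarity of points
  makes \<open>u(\<cdot>,z)\<close> finite at the states visited at positive times, so that the \<open>h\<close>-transform telescopes (\<open>Q_chain\<close>) and \<open>Q\<^sup>z\<^sup>,\<^sup>z\<close> is
  \<open>\<sigma>\<close>-finite (\<open>sigma_finite_Q\<close>). Finally, when both \<open>z\<close> and \<open>y\<close> are restricted to a compact set \<open>K\<close>, the
  total weight \<open>u(z,y) u(y,z)\<close> of the two arcs is controlled by the assumed integrability of
  \<open>(u(z,y) + u(y,z))\<^sup>2\<close>. The laws of the pair of arcs then form a kernel of finite measures in \<open>z\<close>, for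
  which agreement on cylinder sets suffices (\<open>pair_law_swap\<close>), and \<open>K\<close> is increased to the whole state
  space at the end.
\<close>


section \<open>Cutting, gluing and rotating paths\<close>

text \<open>
  The infimum defining the lifetime runs over strictly positive times and need not be attained
  when \<open>L = 0\<close>, so it is only approached by the times \<open>l + e\<close>. In this form the lifetime of each path
  built below is read off from the set of times at which the path is dead.
\<close>
lemma lifetime_eqI:
  assumes "\<And>t. 0 \<le> t \<Longrightarrow> \<omega> t = None \<longleftrightarrow> L \<le> ennreal t"
  shows "lifetime \<omega> = L"
proof (rule antisym)
  show "L \<le> lifetime \<omega>"
    unfolding hitting_time_def using assms by (intro INF_greatest) auto
  show "lifetime \<omega> \<le> L"
  proof (cases L)
    case (real l)
    show ?thesis
    proof (rule ennreal_le_epsilon)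
      fix e :: real assume "0 < e"
      with real assms[of "l + e"] have "\<omega> (l + e) \<in> {None}" "0 < l + e" by auto
      then have "lifetime \<omega> \<le> ennreal (l + e)"
        unfolding hitting_time_def by (intro INF_lower) auto
      then show "lifetime \<omega> \<le> L + ennreal e" using real \<open>0 < e\<close> by simp
    qed
  qed simp
qed

text \<open>
  A path that is glued from two others is right continuous at different times for different
  reasons, hence a notion for a single time.
\<close>
definition right_continuous_at :: "(real \<Rightarrow> 'a::topological_space option) \<Rightarrow> real \<Rightarrow> bool" where
  "right_continuous_at \<omega> t \<longleftrightarrow>
     (\<forall>U. open (Some -` U) \<and> \<omega> t \<in> U \<longrightarrow> (\<forall>\<^sub>F s in at_right t. \<omega> s \<in> U))"

lemma right_continuous_at_None: "\<omega> t = None \<Longrightarrow> right_continuous_at \<omega> t \<Longrightarrow> \<forall>\<^sub>F s in at_right t. \<omega> s = None"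
  unfolding right_continuous_at_def by (drule spec[of _ "{None}"]) (auto simp: vimage_def)

lemma right_continuous_at_Some:
  "\<omega> t = Some x \<Longrightarrow> right_continuous_at \<omega> t \<Longrightarrow> open U \<Longrightarrow> x \<in> U \<Longrightarrow> \<forall>\<^sub>F s in at_right t. \<omega> s \<in> Some ` U"
  unfolding right_continuous_at_def by (drule spec[of _ "Some ` U"]) (auto simp: inj_vimage_image_eq)

lemma right_continuous_at_shift:
  assumes "right_continuous_at \<omega> (t + a)" "\<omega>' t = \<omega> (t + a)"
    and ev: "\<forall>\<^sub>F s in at_right t. \<omega>' s = \<omega> (s + a)"
  shows "right_continuous_at \<omega>' t"
  unfolding right_continuous_at_def
proof (intro allI impI)
  fix U assume U: "open (Some -` U) \<and> \<omega>' t \<in> U"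
  then have "\<forall>\<^sub>F s in at_right (t + a). \<omega> s \<in> U"
    using assms unfolding right_continuous_at_def by auto
  moreover have "at_right (t + a) = filtermap (\<lambda>x. x + a) (at_right t)"
    using filtermap_at_right_shift[of "- a" t] by simp
  ultimately have "\<forall>\<^sub>F s in at_right t. \<omega> (s + a) \<in> U" by (simp add: eventually_filtermap)
  with ev show "\<forall>\<^sub>F s in at_right t. \<omega>' s \<in> U" by eventually_elim simp
qed

lemma path_right_continuous: "\<omega> \<in> path_space \<Longrightarrow> 0 \<le> t \<Longrightarrow> right_continuous_at \<omega> t"
  unfolding path_space_def right_continuous_path_def right_continuous_at_def by auto

text \<open>
  The cemetery is isolated, so a right continuous path that is dead at time \<open>t\<close> is dead immediately
  afterwards. This settles \<open>t = 0\<close>, a time at which the infimum defining the lifetime does not look, and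
  excludes dead starting points for paths of positive lifetime.
\<close>
lemma path_None_iff:
  assumes "\<omega> \<in> path_space" "0 \<le> t"
  shows "\<omega> t = None \<longleftrightarrow> lifetime \<omega> \<le> ennreal t"
proof
  assume "lifetime \<omega> \<le> ennreal t" then show "\<omega> t = None" using assms by (auto simp: path_space_def)
next
  assume None: "\<omega> t = None"
  show "lifetime \<omega> \<le> ennreal t"
  proof (rule ennreal_le_epsilon)
    fix e :: real assume "0 < e"
    from right_continuous_at_None[OF None path_right_continuous[OF assms]]
    obtain b where b: "b > t" "\<And>s. t < s \<Longrightarrow> s < b \<Longrightarrow> \<omega> s = None"
      unfolding eventually_at_right_field by auto
    define s where "s = (t + min b (t + e)) / 2"
    have s: "t < s" "s < b" "s < t + e" using b \<open>0 < e\<close> by (auto simp: s_def min_def field_simps)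
    then have "\<omega> s \<in> {None}" "0 < s" using b assms by auto
    then have "lifetime \<omega> \<le> ennreal s" unfolding hitting_time_def by (intro INF_lower) auto
    also have "\<dots> \<le> ennreal (t + e)" using s by (intro ennreal_leI) simp
    finally show "lifetime \<omega> \<le> ennreal t + ennreal e" using assms \<open>0 < e\<close> by simp
  qed
qed

lemma path_spaceI:
  assumes "\<omega> \<in> extensional {0..}" "\<And>t. 0 \<le> t \<Longrightarrow> right_continuous_at \<omega> t"
    and "\<And>t. 0 \<le> t \<Longrightarrow> \<omega> t = None \<longleftrightarrow> L \<le> ennreal t"
  shows "\<omega> \<in> path_space"
  using assms lifetime_eqI[of \<omega> L, OF assms(3)]
  by (auto simp: path_space_def right_continuous_path_def right_continuous_at_def)

lemma path_eqI:
  "\<omega> \<in> path_space \<Longrightarrow> \<omega>' \<in> path_space \<Longrightarrow> (\<And>t. 0 \<le> t \<Longrightarrow> \<omega> t = \<omega>' t) \<Longrightarrow> \<omega> = \<omega>'"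
  by (rule extensionalityI[of _ "{0..}"]) (auto simp: path_space_def)

definition kill_path :: "real \<Rightarrow> (real \<Rightarrow> 'a option) \<Rightarrow> real \<Rightarrow> 'a option" where
  "kill_path v \<omega> = (\<lambda>t\<in>{0..}. if t < v then \<omega> t else None)"

definition shift_path :: "real \<Rightarrow> (real \<Rightarrow> 'a option) \<Rightarrow> real \<Rightarrow> 'a option" where
  "shift_path v \<omega> = (\<lambda>t\<in>{0..}. \<omega> (v + t))"

text \<open>
  If the first path never dies, the first branch is taken at all times, so the value of
  \<^const>\<open>enn2real\<close> at \<open>\<infinity>\<close> is immaterial.
\<close>
definition concat_path :: "(real \<Rightarrow> 'a option) \<times> (real \<Rightarrow> 'a option) \<Rightarrow> real \<Rightarrow> 'a option" where
  "concat_path p = (\<lambda>t\<in>{0..}. if ennreal t < lifetime (fst p) then fst p t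
                              else snd p (t - enn2real (lifetime (fst p))))"

lemma kill_path_apply: "0 \<le> t \<Longrightarrow> kill_path v \<omega> t = (if t < v then \<omega> t else None)"
  by (simp add: kill_path_def)

lemma shift_path_apply: "0 \<le> t \<Longrightarrow> shift_path v \<omega> t = \<omega> (v + t)"
  by (simp add: shift_path_def)

lemma concat_path_apply:
  "lifetime (fst p) = ennreal l \<Longrightarrow> 0 \<le> l \<Longrightarrow> 0 \<le> t \<Longrightarrow>
    concat_path p t = (if t < l then fst p t else snd p (t - l))"
  by (simp add: concat_path_def ennreal_less_iff)

lemma eventually_at_right_less: "t < b \<Longrightarrow> \<forall>\<^sub>F s in at_right t. s < (b::real)"
  by (auto simp: eventually_at_right_field)

lemma eventually_at_right_greater: "\<forall>\<^sub>F s in at_right t. t < (s::real)"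
  by (auto simp: eventually_at_right_field intro: gt_ex)

lemma kill_path:
  assumes \<omega>: "\<omega> \<in> path_space" and v: "0 \<le> v"
  shows kill_path_in: "kill_path v \<omega> \<in> path_space"
    and lifetime_kill: "lifetime (kill_path v \<omega>) = min (ennreal v) (lifetime \<omega>)"
proof -
  have N: "kill_path v \<omega> t = None \<longleftrightarrow> min (ennreal v) (lifetime \<omega>) \<le> ennreal t" if "0 \<le> t" for t
    using that v path_None_iff[OF \<omega> that] by (auto simp: kill_path_def min_le_iff_disj)
  then show "lifetime (kill_path v \<omega>) = min (ennreal v) (lifetime \<omega>)" by (rule lifetime_eqI)
  show "kill_path v \<omega> \<in> path_space"
  proof (rule path_spaceI[OF _ _ N])
    fix t :: real assume t: "0 \<le> t"
    show "right_continuous_at (kill_path v \<omega>) t"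
    proof (cases "t < v")
      case True
      have "\<forall>\<^sub>F s in at_right t. kill_path v \<omega> s = \<omega> (s + 0)"
        using eventually_at_right_less[OF True] eventually_at_right_greater[of t]
        by eventually_elim (use t in \<open>auto simp: kill_path_def\<close>)
      with path_right_continuous[OF \<omega> t] True t show ?thesis
        by (intro right_continuous_at_shift[of \<omega> t 0]) (auto simp: kill_path_def)
    next
      case False
      have "\<forall>\<^sub>F s in at_right t. kill_path v \<omega> s = None"
        using eventually_at_right_greater[of t]
        by eventually_elim (use t False in \<open>auto simp: kill_path_def\<close>)
      then show ?thesis using t False unfolding right_continuous_at_def
        by (auto simp: kill_path_def elim: eventually_mono)
    qed
  qed (unfold kill_path_def, rule restrict_extensional)
qed

lemma shift_path:
  assumes \<omega>: "\<omega> \<in> path_space" and v: "0 \<le> v"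
  shows shift_path_in: "shift_path v \<omega> \<in> path_space"
    and lifetime_shift: "lifetime (shift_path v \<omega>) = lifetime \<omega> - ennreal v"
proof -
  have N: "shift_path v \<omega> t = None \<longleftrightarrow> lifetime \<omega> - ennreal v \<le> ennreal t" if "0 \<le> t" for t
    using that v path_None_iff[OF \<omega>, of "v + t"]
    by (simp add: shift_path_def ennreal_minus_le_iff)
  then show "lifetime (shift_path v \<omega>) = lifetime \<omega> - ennreal v" by (rule lifetime_eqI)
  show "shift_path v \<omega> \<in> path_space"
  proof (rule path_spaceI[OF _ _ N])
    fix t :: real assume t: "0 \<le> t"
    have "\<forall>\<^sub>F s in at_right t. shift_path v \<omega> s = \<omega> (s + v)"
      using eventually_at_right_greater[of t]
      by eventually_elim (use t in \<open>auto simp: shift_path_def add.commute\<close>)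
    with path_right_continuous[OF \<omega>, of "t + v"] t v show "right_continuous_at (shift_path v \<omega>) t"
      by (intro right_continuous_at_shift[of \<omega> t v]) (auto simp: shift_path_def add.commute)
  qed (unfold shift_path_def, rule restrict_extensional)
qed

lemma concat_path:
  assumes p: "fst p \<in> path_space" "snd p \<in> path_space"
  shows concat_path_in: "concat_path p \<in> path_space"
    and lifetime_concat: "lifetime (concat_path p) = lifetime (fst p) + lifetime (snd p)"
proof -
  have N: "concat_path p t = None \<longleftrightarrow> lifetime (fst p) + lifetime (snd p) \<le> ennreal t" if t: "0 \<le> t" for t
  proof (cases "ennreal t < lifetime (fst p)")
    case True
    then have "\<not> lifetime (fst p) + lifetime (snd p) \<le> ennreal t"
      by (metis le_iff_add le_less_trans not_less order_trans)
    with True show ?thesis using path_None_iff[OF p(1) t] t by (auto simp: concat_path_def)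
  next
    case False
    then obtain l where l: "lifetime (fst p) = ennreal l" "0 \<le> l" "l \<le> t"
      using t by (cases "lifetime (fst p)") (auto simp: not_less top_unique)
    have "lifetime (snd p) \<le> ennreal (t - l) \<longleftrightarrow> ennreal l + lifetime (snd p) \<le> ennreal t"
      using l by (cases "lifetime (snd p)") (auto simp: top_unique simp flip: ennreal_plus)
    then show ?thesis using False l t path_None_iff[OF p(2), of "t - l"]
      by (auto simp: concat_path_def)
  qed
  then show "lifetime (concat_path p) = lifetime (fst p) + lifetime (snd p)" by (rule lifetime_eqI)
  show "concat_path p \<in> path_space"
  proof (rule path_spaceI[OF _ _ N])
    fix t :: real assume t: "0 \<le> t"
    show "right_continuous_at (concat_path p) t"
    proof (cases "ennreal t < lifetime (fst p)")
      case True
      then obtain b where b: "t < b" "ennreal b \<le> lifetime (fst p)"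
      proof (cases "lifetime (fst p)")
        case (real l) then show ?thesis using True that[of l] t by (auto simp: ennreal_less_iff)
      qed (auto intro: that[of "t + 1"])
      have "\<forall>\<^sub>F s in at_right t. concat_path p s = fst p (s + 0)"
        using eventually_at_right_less[OF b(1)] eventually_at_right_greater[of t]
      proof eventually_elim
        case (elim s)
        then have "ennreal s < ennreal b" using t by (intro ennreal_lessI) auto
        with b have "ennreal s < lifetime (fst p)" by simp
        then show ?case using elim t by (auto simp: concat_path_def)
      qed
      with path_right_continuous[OF p(1) t] True t show ?thesis
        by (intro right_continuous_at_shift[of "fst p" t 0]) (auto simp: concat_path_def)
    next
      case False
      then obtain l where l: "lifetime (fst p) = ennreal l" "0 \<le> l" "l \<le> t"
        using t by (cases "lifetime (fst p)") (auto simp: not_less top_unique)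
      have "\<forall>\<^sub>F s in at_right t. concat_path p s = snd p (s + (- l))"
        using eventually_at_right_greater[of t]
        by eventually_elim (use t l in \<open>auto simp: concat_path_apply\<close>)
      with path_right_continuous[OF p(2), of "t + (- l)"] l t show ?thesis
        by (intro right_continuous_at_shift[of "snd p" t "- l"]) (auto simp: concat_path_apply)
    qed
  qed (unfold concat_path_def, rule restrict_extensional)
qed

lemma concat_kill_shift:
  assumes \<omega>: "\<omega> \<in> path_space" and v: "0 \<le> v" "ennreal v < lifetime \<omega>"
  shows "concat_path (kill_path v \<omega>, shift_path v \<omega>) = \<omega>"
proof (rule path_eqI)
  show "concat_path (kill_path v \<omega>, shift_path v \<omega>) \<in> path_space"
    using \<omega> v by (intro concat_path_in) (auto simp: kill_path_in shift_path_in)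
  have "lifetime (kill_path v \<omega>) = ennreal v" using lifetime_kill[OF \<omega> v(1)] v by (simp add: min_absorb1)
  then show "concat_path (kill_path v \<omega>, shift_path v \<omega>) t = \<omega> t" if "0 \<le> t" for t
    using that v by (subst concat_path_apply[where l = v]) (auto simp: kill_path_apply shift_path_apply)
qed fact

definition loops :: "(real \<Rightarrow> 'a::topological_space option) set" where
  "loops = {\<omega> \<in> path_space. 0 < lifetime \<omega> \<and> lifetime \<omega> < \<infinity>}"

lemma loops_lifetime:
  assumes "\<omega> \<in> loops" obtains l where "0 < l" "lifetime \<omega> = ennreal l"
  using assms by (cases "lifetime \<omega>") (auto simp: loops_def)

lemma loop_rotation_apply:
  assumes "\<omega> \<in> loops" "lifetime \<omega> = ennreal l" "0 < l" "0 \<le> s"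
  shows "loop_rotation v \<omega> s = (if s < l then \<omega> ((s + v) rmod l) else None)"
  using assms by (simp add: loop_rotation_def ennreal_less_iff)

text \<open>
  For a time \<open>v\<close> inside the lifetime \<open>l\<close> the sum \<open>s + v\<close> passes \<open>l\<close> at most once, so its residue is
  \<open>s + v\<close> or \<open>s + v - l\<close>. The first case runs through the arc after \<open>v\<close>, the second through the arc
  before \<open>v\<close>: rotation exchanges the two arcs of the loop cut at \<open>v\<close>.
\<close>
lemma loop_rotation_concat:
  assumes \<omega>: "\<omega> \<in> loops" and v: "0 \<le> v" "ennreal v < lifetime \<omega>"
  shows "loop_rotation v \<omega> = concat_path (shift_path v \<omega>, kill_path v \<omega>)"
proof -
  have p: "\<omega> \<in> path_space" using \<omega> by (simp add: loops_def)
  obtain l where l: "0 < l" "lifetime \<omega> = ennreal l" using loops_lifetime[OF \<omega>] .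
  have vl: "v < l" using v l by (simp add: ennreal_less_iff)
  have L: "lifetime (shift_path v \<omega>) = ennreal (l - v)"
    using lifetime_shift[OF p v(1)] l v by (simp add: ennreal_minus)
  have "loop_rotation v \<omega> t = concat_path (shift_path v \<omega>, kill_path v \<omega>) t" for t
  proof (cases "0 \<le> t")
    case t: True
    consider "t < l - v" | "l - v \<le> t" "t < l" | "l \<le> t" by linarith
    then show ?thesis
    proof cases
      case 1
      then show ?thesis using t v vl l
        by (subst concat_path_apply[where l = "l - v"]) (auto simp: loop_rotation_apply[OF \<omega> l(2,1)] L shift_path_apply add.commute)
    next
      case 2
      have *: "(t + v) rmod l = t + v - l"
        using 2 l vl by (intro rmod_unique[of _ _ _ 1]) auto
      then show ?thesis using t v vl l 2
        by (subst concat_path_apply[where l = "l - v"]) (auto simp: loop_rotation_apply[OF \<omega> l(2,1)] L kill_path_apply * diff_diff_eq2)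
    next
      case 3
      then show ?thesis using t v vl l path_None_iff[OF p, of "t - (l - v)"]
        by (subst concat_path_apply[where l = "l - v"]) (auto simp: loop_rotation_apply[OF \<omega> l(2,1)] L kill_path_apply algebra_simps)
    qed
  qed (use l in \<open>auto simp: loop_rotation_def concat_path_def\<close>)
  then show ?thesis by auto
qed

lemma loop_rotation_rmod:
  assumes \<omega>: "\<omega> \<in> loops" "lifetime \<omega> = ennreal l" "0 < l"
  shows "loop_rotation v \<omega> = loop_rotation (v rmod l) \<omega>"
proof -
  have "(s + v) rmod l = (s + v rmod l) rmod l" for s
    by (metis rmod_add rmod_rmod)
  then show ?thesis using assms by (auto simp: loop_rotation_def fun_eq_iff restrict_def)
qed

text \<open>
  Only the residue of \<open>v\<close> modulo the lifetime matters, so the rotation is an exchange of two arcs,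
  whose lifetimes add up to that of the loop.
\<close>
lemma loop_rotation_loops:
  assumes \<omega>: "\<omega> \<in> loops"
  shows lifetime_loop_rotation: "lifetime (loop_rotation v \<omega>) = lifetime \<omega>"
    and loop_rotation_in: "loop_rotation v \<omega> \<in> loops"
proof -
  obtain l where l: "0 < l" "lifetime \<omega> = ennreal l" using loops_lifetime[OF \<omega>] .
  have p: "\<omega> \<in> path_space" using \<omega> by (simp add: loops_def)
  let ?w = "v rmod l"
  have w: "0 \<le> ?w" "?w < l" using l by (auto intro: rmod_less rmod_nonneg)
  have eq: "loop_rotation v \<omega> = concat_path (shift_path ?w \<omega>, kill_path ?w \<omega>)"
    unfolding loop_rotation_rmod[OF \<omega> l(2,1), of v]
    by (rule loop_rotation_concat[OF \<omega>]) (use w l in \<open>auto simp: ennreal_less_iff\<close>)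
  have "lifetime (loop_rotation v \<omega>) = ennreal l - ennreal ?w + ennreal ?w"
    unfolding eq using p w l
    by (subst lifetime_concat)
       (auto simp: kill_path_in shift_path_in lifetime_shift lifetime_kill min_def ennreal_le_iff2)
  also have "\<dots> = ennreal l" using w by (intro diff_add_cancel_ennreal) (simp add: ennreal_leI)
  finally show "lifetime (loop_rotation v \<omega>) = lifetime \<omega>" using l by simp
  moreover have "loop_rotation v \<omega> \<in> path_space"
    unfolding eq using p w by (intro concat_path_in) (auto simp: kill_path_in shift_path_in)
  ultimately show "loop_rotation v \<omega> \<in> loops" using \<omega> by (simp add: loops_def)
qed

lemma loop_rotation_add:
  assumes \<omega>: "\<omega> \<in> loops"
  shows "loop_rotation w (loop_rotation v \<omega>) = loop_rotation (w + v) \<omega>"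
proof (rule path_eqI)
  obtain l where l: "0 < l" "lifetime \<omega> = ennreal l" using loops_lifetime[OF \<omega>] .
  have \<omega>': "loop_rotation v \<omega> \<in> loops" "lifetime (loop_rotation v \<omega>) = ennreal l"
    using loop_rotation_loops[OF \<omega>] l by auto
  show "loop_rotation w (loop_rotation v \<omega>) \<in> path_space" "loop_rotation (w + v) \<omega> \<in> path_space"
    using loop_rotation_in[OF \<omega>'(1)] loop_rotation_in[OF \<omega>] by (auto simp: loops_def)
  fix t :: real assume t: "0 \<le> t"
  have *: "((t + w) rmod l + v) rmod l = (t + (w + v)) rmod l"
    by (metis add.assoc rmod_add rmod_rmod)
  show "loop_rotation w (loop_rotation v \<omega>) t = loop_rotation (w + v) \<omega> t"
    using t l rmod_less[of l "t + w"] rmod_nonneg[of l "t + w"]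
    by (simp add: loop_rotation_apply[OF \<omega>' l(1)] loop_rotation_apply[OF \<omega> l(2,1)] *)
qed


section \<open>Measurability of operations on paths\<close>

text \<open>
  The Borel sets of the state space with an isolated cemetery. Generating them by open sets
  allows limits of paths to be treated topologically.
\<close>
definition state_algebra :: "'a::topological_space option measure" where
  "state_algebra = sigma UNIV {Some ` U | U. open U}"

lemma space_state_algebra [simp]: "space state_algebra = UNIV"
  by (simp add: state_algebra_def)

lemma Some_image_in_state_algebra:
  assumes "A \<in> sets borel" shows "Some ` A \<in> sets state_algebra"
proof -
  from assms have "A \<in> sigma_sets UNIV {S. open S}" by (simp add: borel_def)
  then show ?thesis
  proof induct
    case (Basic a) then show ?case by (auto simp: state_algebra_def)
  next
    case (Compl a)
    have "Some ` (UNIV - a) = Some ` UNIV - Some ` a" by auto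
    moreover have "Some ` (UNIV :: 'a set) \<in> sets state_algebra" by (auto simp: state_algebra_def)
    ultimately show ?case using Compl by auto
  qed (auto simp: image_UN)
qed

lemma None_in_state_algebra: "{None} \<in> sets state_algebra"
proof -
  have "{None} = space state_algebra - Some ` UNIV" by (auto simp: UNIV_option_conv)
  also have "\<dots> \<in> sets state_algebra"
    by (intro sets.compl_sets Some_image_in_state_algebra) simp
  finally show ?thesis .
qed

lemma measurable_state_algebraI:
  assumes "\<And>U. open U \<Longrightarrow> {x \<in> space N. f x \<in> Some ` U} \<in> sets N"
  shows "f \<in> N \<rightarrow>\<^sub>M state_algebra"
  unfolding state_algebra_def using assms
  by (intro measurable_measure_of) (auto simp: vimage_def Int_def conj_commute)

lemma measurable_ext0 [measurable]:
  assumes [measurable]: "g \<in> borel_measurable borel"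
  shows "ext0 g \<in> borel_measurable state_algebra"
proof (rule measurableI)
  fix B :: "ennreal set" assume [measurable]: "B \<in> sets borel"
  have "ext0 g -` B \<inter> space state_algebra = Some ` (g -` B \<inter> space borel) \<union> (if 0 \<in> B then {None} else {})"
    by (auto simp: ext0_def split: option.splits if_splits)
  also have "\<dots> \<in> sets state_algebra"
    using None_in_state_algebra by (intro sets.Un Some_image_in_state_algebra) (measurable, auto)
  finally show "ext0 g -` B \<inter> space state_algebra \<in> sets state_algebra" .
qed simp

lemma space_path_algebra [simp]: "space path_algebra = path_space"
  unfolding path_algebra_def by (rule space_measure_of) auto

lemma measurable_coordinate:
  assumes "0 \<le> t" shows "(\<lambda>\<omega>. \<omega> t) \<in> path_algebra \<rightarrow>\<^sub>M state_algebra"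
proof (rule measurable_state_algebraI)
  fix U :: "'a set" assume "open U"
  then show "{x \<in> space path_algebra. x t \<in> Some ` U} \<in> sets path_algebra"
    using assms unfolding space_path_algebra
    unfolding path_algebra_def by (intro in_measure_of) (auto intro!: exI[of _ t] exI[of _ U])
qed

lemma measurable_path_algebraI:
  fixes f :: "'b \<Rightarrow> real \<Rightarrow> 'a::topological_space option"
  assumes "\<And>x. x \<in> space N \<Longrightarrow> f x \<in> path_space"
    and "\<And>t. 0 \<le> t \<Longrightarrow> (\<lambda>x. f x t) \<in> N \<rightarrow>\<^sub>M state_algebra"
  shows "f \<in> N \<rightarrow>\<^sub>M path_algebra"
  unfolding path_algebra_def
proof (rule measurable_measure_of)
  fix Y :: "(real \<Rightarrow> 'a option) set"
  assume "Y \<in> {{\<omega> \<in> path_space. \<omega> t \<in> Some ` A} |t A. 0 \<le> t \<and> A \<in> sets borel}"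
  then obtain t A where Y: "Y = {\<omega> \<in> path_space. \<omega> t \<in> Some ` A}" "0 \<le> t" "A \<in> sets borel" by auto
  have "f -` Y \<inter> space N = (\<lambda>x. f x t) -` (Some ` A) \<inter> space N" using assms(1) Y by auto
  then show "f -` Y \<inter> space N \<in> sets N"
    using measurable_sets[OF assms(2)[OF Y(2)] Some_image_in_state_algebra[OF Y(3)]] by simp
qed (use assms(1) in auto)

lemma measurable_lifetime [measurable]: "lifetime \<in> borel_measurable path_algebra"
proof (rule borel_measurableI_le)
  fix y :: ennreal
  show "{x \<in> space path_algebra. lifetime x \<le> y} \<in> sets path_algebra"
  proof (cases y)
    case (real r)
    then have eq: "{x \<in> space path_algebra. lifetime x \<le> y} = (\<lambda>\<omega>. \<omega> r) -` {None} \<inter> space path_algebra"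
      using path_None_iff[of _ r] by auto
    show ?thesis unfolding eq using real by (intro measurable_sets[OF measurable_coordinate None_in_state_algebra])
  qed (auto intro!: sets.top simp del: space_path_algebra simp: space_path_algebra[symmetric])
qed

text \<open>
  A locally compact Hausdorff space is regular, so every point of \<open>U\<close> has a basic neighbourhood whose
  closure lies in \<open>U\<close>. This exhaustion of \<open>U\<close> does the work of a metric in the next lemmas.
\<close>
lemma open_countable_closure_cover:
  fixes U :: "'a::{second_countable_topology, t2_space} set"
  assumes "locally_compact_space (euclidean :: 'a topology)" "open U"
  obtains \<V> where "countable \<V>" "\<And>V. V \<in> \<V> \<Longrightarrow> open V \<and> closure V \<subseteq> U" "\<Union>\<V> = U"
proof -
  have "Hausdorff_space (euclidean :: 'a topology)"
    unfolding Hausdorff_space_def using hausdorff by (simp add: disjnt_def) blast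
  then have reg: "regular_space (euclidean :: 'a topology)"
    by (rule locally_compact_Hausdorff_imp_regular_space[OF assms(1)])
  obtain B :: "'a set set" where B: "countable B" "topological_basis B" using ex_countable_basis by auto
  define \<V> where "\<V> = {V \<in> B. closure V \<subseteq> U}"
  show ?thesis
  proof (rule that[of \<V>])
    show "countable \<V>" using B by (auto simp: \<V>_def)
    show "open V \<and> closure V \<subseteq> U" if "V \<in> \<V>" for V
      using that B topological_basis_open by (auto simp: \<V>_def)
    show "\<Union>\<V> = U"
    proof
      show "\<Union>\<V> \<subseteq> U" using closure_subset by (auto simp: \<V>_def)
      show "U \<subseteq> \<Union>\<V>"
      proof
        fix x assume "x \<in> U"
        then obtain W where W: "open W" "x \<in> W" "disjnt (- U) (closure W)"
          using reg assms(2) unfolding regular_space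
          by (auto simp: closed_Compl dest!: spec[of _ "- U"] spec[of _ x])
        obtain V where "V \<in> B" "x \<in> V" "V \<subseteq> W" using topological_basisE[OF B(2) W(1,2)] by auto
        then show "x \<in> \<Union>\<V>" using W closure_mono[of V W] by (auto simp: \<V>_def disjnt_def)
      qed
    qed
  qed
qed

text \<open>
  The least dyadic number of level \<open>n\<close> strictly above \<open>t\<close>. Strictness places the approximating times
  in the right neighbourhood filter of \<open>t\<close>, where right continuity applies.
\<close>
definition dyadic_above :: "nat \<Rightarrow> real \<Rightarrow> real" where
  "dyadic_above n t = (of_int \<lfloor>t * 2 ^ n\<rfloor> + 1) / 2 ^ n"

lemma dyadic_above: "t < dyadic_above n t" "dyadic_above n t \<le> t + 1 / 2 ^ n"
proof -
  have "t * 2 ^ n < of_int \<lfloor>t * 2 ^ n\<rfloor> + 1" "of_int \<lfloor>t * 2 ^ n\<rfloor> \<le> t * 2 ^ n" by linarith+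
  then show "t < dyadic_above n t" "dyadic_above n t \<le> t + 1 / 2 ^ n"
    by (simp_all add: dyadic_above_def field_simps)
qed

lemma dyadic_above_tendsto: "filterlim (\<lambda>n. dyadic_above n t) (at_right t) sequentially"
proof (rule tendsto_imp_filterlim_at_right)
  have "(\<lambda>n. t + 1 / 2 ^ n) \<longlonglongrightarrow> t + 0"
    by (intro tendsto_intros LIMSEQ_divide_realpow_zero) auto
  then have upper: "(\<lambda>n. t + 1 / 2 ^ n) \<longlonglongrightarrow> t" by simp
  show "(\<lambda>n. dyadic_above n t) \<longlonglongrightarrow> t"
    by (rule tendsto_sandwich[OF _ _ tendsto_const upper])
       (simp_all add: dyadic_above(2) less_imp_le[OF dyadic_above(1)])
qed (intro always_eventually allI dyadic_above(1))

context
  assumes lc: "locally_compact_space (euclidean :: 'a::{second_countable_topology, t2_space} topology)"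
begin

text \<open>
  At the approximating times, which take countably many values, the evaluation is measurable. A right
  continuous path is in the open set \<open>U\<close> at time \<open>g\<close> if and only if, for one of countably many open
  \<open>V\<close> with closure inside \<open>U\<close>, it is in \<open>V\<close> at all late approximating times: being in \<open>V\<close> near \<open>g\<close>
  from the right puts the value at \<open>g\<close> into the closure of \<open>V\<close>.
\<close>
lemma measurable_evaluate:
  fixes f :: "'b \<Rightarrow> real \<Rightarrow> 'a option"
  assumes f: "f \<in> N \<rightarrow>\<^sub>M path_algebra" and g [measurable]: "g \<in> borel_measurable N"
    and g0: "\<And>x. x \<in> space N \<Longrightarrow> 0 \<le> g x"
  shows "(\<lambda>x. f x (g x)) \<in> N \<rightarrow>\<^sub>M state_algebra"
proof (rule measurable_state_algebraI)
  have fp: "f x \<in> path_space" if "x \<in> space N" for x using measurable_space[OF f that] by simp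
  have ev [measurable]: "(\<lambda>x. f x (dyadic_above n (g x))) \<in> N \<rightarrow>\<^sub>M state_algebra" for n
  proof -
    have "(\<lambda>x. f x (max 0 ((of_int \<lfloor>g x * 2 ^ n\<rfloor> + 1) / 2 ^ n))) \<in> N \<rightarrow>\<^sub>M state_algebra"
    proof (rule measurable_compose_countable[where f = "\<lambda>i x. f x (max 0 ((of_int i + 1) / 2 ^ n))"])
      show "(\<lambda>x. f x (max 0 ((of_int i + 1) / 2 ^ n))) \<in> N \<rightarrow>\<^sub>M state_algebra" for i
        using measurable_compose[OF f measurable_coordinate] by simp
    qed measurable
    moreover have "max 0 ((of_int \<lfloor>g x * 2 ^ n\<rfloor> + 1) / 2 ^ n) = dyadic_above n (g x)" if "x \<in> space N" for x
      using dyadic_above(1)[of "g x" n] g0[OF that] by (simp add: dyadic_above_def)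
    ultimately show ?thesis by (simp cong: measurable_cong)
  qed
  fix U :: "'a set" assume U: "open U"
  obtain \<V> where \<V>: "countable \<V>" "\<And>V. V \<in> \<V> \<Longrightarrow> open V \<and> closure V \<subseteq> U" "\<Union>\<V> = U"
    using open_countable_closure_cover[OF lc U] by metis
  have "{x \<in> space N. f x (g x) \<in> Some ` U} =
    (\<Union>V\<in>\<V>. {x \<in> space N. \<exists>k. \<forall>n\<ge>k. f x (dyadic_above n (g x)) \<in> Some ` V})" (is "?L = ?R")
  proof (intro equalityI subsetI)
    fix x assume "x \<in> ?L"
    then obtain y V where x: "x \<in> space N" "f x (g x) = Some y" "y \<in> V" "V \<in> \<V>" using \<V>(3) by auto
    have "\<forall>\<^sub>F s in at_right (g x). f x s \<in> Some ` V"
      using path_right_continuous[OF fp g0] x \<V>(2) by (intro right_continuous_at_Some) auto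
    then have "\<forall>\<^sub>F n in sequentially. f x (dyadic_above n (g x)) \<in> Some ` V"
      by (rule eventually_compose_filterlim[OF _ dyadic_above_tendsto])
    then show "x \<in> ?R" using x by (auto simp: eventually_sequentially)
  next
    fix x assume "x \<in> ?R"
    then obtain V k where x: "x \<in> space N" "V \<in> \<V>"
      and k: "\<And>n. n \<ge> k \<Longrightarrow> f x (dyadic_above n (g x)) \<in> Some ` V" by blast
    \<comment> \<open>late approximating times lie in every right neighbourhood of \<open>g x\<close>\<close>
    have contra: False if "\<forall>\<^sub>F s in at_right (g x). f x s \<notin> Some ` V"
    proof -
      have "\<forall>\<^sub>F n in sequentially. f x (dyadic_above n (g x)) \<notin> Some ` V"
        by (rule eventually_compose_filterlim[OF that dyadic_above_tendsto])
      then obtain k' where "\<And>n. n \<ge> k' \<Longrightarrow> f x (dyadic_above n (g x)) \<notin> Some ` V"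
        by (auto simp: eventually_sequentially)
      from this[of "max k k'"] k[of "max k k'"] show False by auto
    qed
    have rc: "right_continuous_at (f x) (g x)" using path_right_continuous[OF fp g0] x by auto
    show "x \<in> ?L"
    proof (cases "f x (g x)")
      case None
      have "\<forall>\<^sub>F s in at_right (g x). f x s \<notin> Some ` V"
        using right_continuous_at_None[OF None rc] by eventually_elim auto
      then show ?thesis using contra by auto
    next
      case (Some y)
      have "y \<in> closure V"
      proof (rule ccontr)
        assume "y \<notin> closure V"
        then have "\<forall>\<^sub>F s in at_right (g x). f x s \<in> Some ` (- closure V)"
          by (intro right_continuous_at_Some[OF Some rc]) auto
        then have "\<forall>\<^sub>F s in at_right (g x). f x s \<notin> Some ` V"
          by eventually_elim (use closure_subset[of V] in auto)
        then show False by (rule contra)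
      qed
      then show ?thesis using x Some \<V>(2) by auto
    qed
  qed
  also have "\<dots> \<in> sets N"
  proof (intro sets.countable_UN'' \<V>)
    fix V assume "V \<in> \<V>"
    then have [measurable]: "Some ` V \<in> sets state_algebra" using \<V>(2) by (auto intro!: Some_image_in_state_algebra)
    show "{x \<in> space N. \<exists>k. \<forall>n\<ge>k. f x (dyadic_above n (g x)) \<in> Some ` V} \<in> sets N" by measurable
  qed
  finally show "?L \<in> sets N" .
qed

lemma measurable_kill_path:
  fixes f :: "'b \<Rightarrow> real \<Rightarrow> 'a option"
  assumes f: "f \<in> N \<rightarrow>\<^sub>M path_algebra" and g [measurable]: "g \<in> borel_measurable N"
    and g0: "\<And>x. x \<in> space N \<Longrightarrow> 0 \<le> g x"
  shows "(\<lambda>x. kill_path (g x) (f x)) \<in> N \<rightarrow>\<^sub>M path_algebra"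
proof (rule measurable_path_algebraI)
  show "kill_path (g x) (f x) \<in> path_space" if "x \<in> space N" for x
    using measurable_space[OF f that] g0[OF that] by (auto intro: kill_path_in)
  fix t :: real assume t: "0 \<le> t"
  note [measurable] = measurable_compose[OF f measurable_coordinate[OF t]]
  show "(\<lambda>x. kill_path (g x) (f x) t) \<in> N \<rightarrow>\<^sub>M state_algebra"
    unfolding kill_path_apply[OF t] by measurable
qed

lemma measurable_shift_path:
  fixes f :: "'b \<Rightarrow> real \<Rightarrow> 'a option"
  assumes f: "f \<in> N \<rightarrow>\<^sub>M path_algebra" and g [measurable]: "g \<in> borel_measurable N"
    and g0: "\<And>x. x \<in> space N \<Longrightarrow> 0 \<le> g x"
  shows "(\<lambda>x. shift_path (g x) (f x)) \<in> N \<rightarrow>\<^sub>M path_algebra"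
proof (rule measurable_path_algebraI)
  show "shift_path (g x) (f x) \<in> path_space" if "x \<in> space N" for x
    using measurable_space[OF f that] g0[OF that] by (auto intro: shift_path_in)
  fix t :: real assume t: "0 \<le> t"
  show "(\<lambda>x. shift_path (g x) (f x) t) \<in> N \<rightarrow>\<^sub>M state_algebra"
    unfolding shift_path_apply[OF t] by (rule measurable_evaluate[OF f]) (use g0 t in auto)
qed

lemma measurable_concat_path:
  "concat_path \<in> (path_algebra \<Otimes>\<^sub>M path_algebra :: ((real \<Rightarrow> 'a option) \<times> _) measure) \<rightarrow>\<^sub>M path_algebra"
proof (rule measurable_path_algebraI)
  let ?N = "path_algebra \<Otimes>\<^sub>M path_algebra :: ((real \<Rightarrow> 'a option) \<times> (real \<Rightarrow> 'a option)) measure"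
  show "concat_path p \<in> path_space" if "p \<in> space ?N" for p
    using that by (auto simp: space_pair_measure intro!: concat_path_in)
  fix t :: real assume t: "0 \<le> t"
  have [measurable]: "(\<lambda>p. fst p t) \<in> ?N \<rightarrow>\<^sub>M state_algebra"
    using measurable_compose[OF measurable_fst measurable_coordinate[OF t]] .
  have [measurable]: "(\<lambda>p. snd p (max 0 (t - enn2real (lifetime (fst p))))) \<in> ?N \<rightarrow>\<^sub>M state_algebra"
    by (rule measurable_evaluate) auto
  have "concat_path p t = (if ennreal t < lifetime (fst p) then fst p t
      else snd p (max 0 (t - enn2real (lifetime (fst p)))))" for p :: "(real \<Rightarrow> 'a option) \<times> (real \<Rightarrow> 'a option)"
    using t by (cases "lifetime (fst p)") (auto simp: concat_path_def ennreal_less_iff)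
  then show "(\<lambda>p. concat_path p t) \<in> ?N \<rightarrow>\<^sub>M state_algebra" by simp
qed

lemma measurable_loop_rotation:
  fixes f :: "'b \<Rightarrow> real \<Rightarrow> 'a option"
  assumes f [measurable]: "f \<in> N \<rightarrow>\<^sub>M path_algebra" and g [measurable]: "g \<in> borel_measurable N"
  shows "(\<lambda>x. loop_rotation (g x) (f x)) \<in> N \<rightarrow>\<^sub>M path_algebra"
proof (rule measurable_path_algebraI)
  show "loop_rotation (g x) (f x) \<in> path_space" if "x \<in> space N" for x
  proof (cases "f x \<in> loops")
    case True then show ?thesis using loop_rotation_in by (auto simp: loops_def)
  next
    case False
    then show ?thesis using measurable_space[OF f that] by (auto simp: loops_def loop_rotation_def)
  qed
  fix t :: real assume t: "0 \<le> t"
  have [measurable]: "(\<lambda>x. f x t) \<in> N \<rightarrow>\<^sub>M state_algebra"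
    using measurable_compose[OF f measurable_coordinate[OF t]] .
  have [measurable]: "(\<lambda>x. f x (max 0 ((t + g x) rmod enn2real (lifetime (f x))))) \<in> N \<rightarrow>\<^sub>M state_algebra"
    unfolding rmod_def by (rule measurable_evaluate[OF f]) auto
  have "loop_rotation (g x) (f x) t =
     (if 0 < lifetime (f x) \<and> lifetime (f x) < \<infinity>
      then (if ennreal t < lifetime (f x) then f x (max 0 ((t + g x) rmod enn2real (lifetime (f x)))) else None)
      else f x t)" for x
    using t rmod_nonneg[of "enn2real (lifetime (f x))" "t + g x"]
    by (cases "lifetime (f x)") (auto simp: loop_rotation_def max_def)
  then show "(\<lambda>x. loop_rotation (g x) (f x) t) \<in> N \<rightarrow>\<^sub>M state_algebra" by simp
qed

end


section \<open>Finite-dimensional distributions and cylinder sets\<close>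

text \<open>
  A variant of \<^const>\<open>chain_int\<close> whose innermost integrand is a function \<open>h\<close> of the last state. With
  \<open>h = u(\<cdot>,z)\<close> it expresses the finite-dimensional distributions of \<open>Q\<^sup>z\<^sup>,\<^sup>z\<close> by the semigroup \<open>P\<close> itself,
  without denominators.
\<close>
primrec chain_term ::
  "(real \<Rightarrow> 'a \<Rightarrow> 'a measure) \<Rightarrow> ('a \<Rightarrow> ennreal) \<Rightarrow> real \<Rightarrow> 'a \<Rightarrow> (real \<times> ('a \<Rightarrow> ennreal)) list \<Rightarrow> ennreal"
where
  "chain_term P h s x [] = h x"
| "chain_term P h s x (p # ps) =
     (\<integral>\<^sup>+ y. snd p y * chain_term P h (fst p) y ps \<partial>P (fst p - s) x)"

lemma chain_int_eq_chain_term: "chain_int P s x ps = chain_term P (\<lambda>_. 1) s x ps"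
  by (induct ps arbitrary: s x) simp_all

lemma chain_term_append:
  "chain_term P h s x (ps @ qs) =
     chain_term P (\<lambda>y. chain_term P h (last (s # map fst ps)) y qs) s x ps"
  by (induct ps arbitrary: s x) simp_all

lemma chain_term_translate:
  "chain_term P h (v + s) x (map (map_prod ((+) v) id) ps) = chain_term P h s x ps"
  by (induct ps arbitrary: s x) simp_all

text \<open>
  The lists that may follow a state at time \<open>s\<close>: the times increase strictly and start after \<open>s\<close>.
\<close>
definition admissible :: "real \<Rightarrow> (real \<times> ('a::topological_space \<Rightarrow> ennreal)) list \<Rightarrow> bool" where
  "admissible s ps \<longleftrightarrow> sorted_wrt (<) (s # map fst ps) \<and> (\<forall>p\<in>set ps. snd p \<in> borel_measurable borel)"

lemma admissible_Nil [simp]: "admissible s []"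
  by (simp add: admissible_def)

lemma admissible_Cons [simp]:
  "admissible s (p # ps) \<longleftrightarrow> s < fst p \<and> snd p \<in> borel_measurable borel \<and> admissible (fst p) ps"
  by (auto simp: admissible_def)

lemma admissible_append:
  "admissible s (ps @ qs) \<longleftrightarrow> admissible s ps \<and> admissible (last (s # map fst ps)) qs"
  by (induct ps arbitrary: s) auto

lemma admissible_translate: "admissible (v + s) (map (map_prod ((+) v) id) ps) = admissible s ps"
  by (induct ps arbitrary: s) auto

definition cylinder :: "real set \<Rightarrow> (real \<Rightarrow> 'a set) \<Rightarrow> (real \<Rightarrow> 'a::topological_space option) set" where
  "cylinder J A = {\<omega> \<in> path_space. \<forall>t\<in>J. \<omega> t \<in> Some ` A t}"

definition cylinders :: "(real \<Rightarrow> 'a::topological_space option) set set" where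
  "cylinders = {cylinder J A | J A. finite J \<and> J \<subseteq> {0..} \<and> (\<forall>t. A t \<in> sets borel)}"

text \<open>
  A cylinder set in the format of \<^const>\<open>markov_law\<close>, with its times in increasing order.
\<close>
definition cylinder_list :: "real set \<Rightarrow> (real \<Rightarrow> 'a set) \<Rightarrow> (real \<times> ('a \<Rightarrow> ennreal)) list" where
  "cylinder_list J A = map (\<lambda>t. (t, indicator (A t))) (sorted_list_of_set J)"

lemma cylindersI: "finite J \<Longrightarrow> J \<subseteq> {0..} \<Longrightarrow> (\<And>t. A t \<in> sets borel) \<Longrightarrow> cylinder J A \<in> cylinders"
  by (auto simp: cylinders_def)

lemma path_space_in_cylinders: "path_space \<in> cylinders"
  using cylindersI[of "{}" "\<lambda>_. {}"] by (simp add: cylinder_def)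

lemma cylinders_subset: "cylinders \<subseteq> Pow path_space"
  by (auto simp: cylinders_def cylinder_def)

lemma Int_stable_cylinders: "Int_stable cylinders"
proof (rule Int_stableI)
  fix a b :: "(real \<Rightarrow> 'a option) set" assume "a \<in> cylinders" "b \<in> cylinders"
  then obtain J A J' A' where a: "a = cylinder J A" "finite J" "J \<subseteq> {0..}" "\<And>t. A t \<in> sets borel"
    and b: "b = cylinder J' A'" "finite J'" "J' \<subseteq> {0..}" "\<And>t. A' t \<in> sets borel"
    by (auto simp: cylinders_def)
  have "a \<inter> b = cylinder (J \<union> J') (\<lambda>t. (if t \<in> J then A t else UNIV) \<inter> (if t \<in> J' then A' t else UNIV))"
    unfolding a b cylinder_def by (auto simp: image_Int split: if_splits)
  also have "\<dots> \<in> cylinders" using a b by (intro cylindersI) auto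
  finally show "a \<inter> b \<in> cylinders" .
qed

lemma cylinder_in_sets:
  assumes "finite J" "J \<subseteq> {0..}" "\<And>t. A t \<in> sets borel"
  shows "cylinder J A \<in> sets path_algebra"
proof -
  have eq: "cylinder J A = {\<omega> \<in> space path_algebra. \<forall>t\<in>J. \<omega> t \<in> Some ` A t}"
    by (simp add: cylinder_def)
  show ?thesis unfolding eq
  proof (rule sets.sets_Collect_finite_All[OF _ assms(1)])
    fix t assume "t \<in> J"
    then have "(\<lambda>\<omega>. \<omega> t) -` (Some ` A t) \<inter> space path_algebra \<in> sets path_algebra"
      using assms by (intro measurable_sets[OF measurable_coordinate] Some_image_in_state_algebra) auto
    then show "{\<omega> \<in> space path_algebra. \<omega> t \<in> Some ` A t} \<in> sets path_algebra"
      by (simp add: vimage_def Int_def conj_commute)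
  qed
qed

lemma sets_path_algebra_cylinders: 
  "sets (path_algebra :: (real \<Rightarrow> 'a::topological_space option) measure) = sigma_sets path_space cylinders"
proof
  show "sigma_sets path_space (cylinders :: (real \<Rightarrow> 'a option) set set) \<subseteq> sets path_algebra"
    using sets.sigma_sets_subset[of cylinders path_algebra] cylinder_in_sets
    by (auto simp: cylinders_def)
  have "{{\<omega> \<in> path_space :: (real \<Rightarrow> 'a option) set. \<omega> t \<in> Some ` A} | t A. 0 \<le> t \<and> A \<in> sets borel} \<subseteq> cylinders"
  proof clarify
    fix t :: real and A :: "'a set" assume "0 \<le> t" "A \<in> sets borel"
    then have "cylinder {t} (\<lambda>_. A) \<in> cylinders" by (intro cylindersI) auto
    then show "{\<omega> \<in> path_space. \<omega> t \<in> Some ` A} \<in> cylinders" by (simp add: cylinder_def)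
  qed
  then show "sets path_algebra \<subseteq> sigma_sets path_space (cylinders :: (real \<Rightarrow> 'a option) set set)"
    unfolding path_algebra_def by (simp add: sets_measure_of_conv sigma_sets_mono' sigma_sets.Empty sigma_sets_top)
qed

lemma indicator_cylinder:
  assumes "\<omega> \<in> path_space" "finite J"
  shows "indicator (cylinder J A) \<omega> = (\<Prod>(s, g)\<leftarrow>cylinder_list J A. ext0 g (\<omega> s))"
proof -
  have *: "ext0 (indicator B) y = (indicator (Some ` B) y :: ennreal)" for B and y :: "'a option"
    by (cases y) (auto simp: ext0_def indicator_def)
  have "(\<Prod>(s, g)\<leftarrow>cylinder_list J A. ext0 g (\<omega> s)) = (\<Prod>t\<leftarrow>sorted_list_of_set J. indicator (Some ` A t) (\<omega> t))"
    by (simp add: cylinder_list_def o_def *)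
  also have "\<dots> = (\<Prod>t\<in>J. indicator (Some ` A t) (\<omega> t))"
    using assms(2) by (subst prod.distinct_set_conv_list[symmetric]) auto
  also have "\<dots> = (if \<forall>t\<in>J. \<omega> t \<in> Some ` A t then 1 else 0)"
    using assms(2) by (induct J rule: finite_induct) (auto simp: indicator_def)
  also have "\<dots> = indicator (cylinder J A) \<omega>" using assms(1) by (auto simp: cylinder_def)
  finally show ?thesis ..
qed

lemma admissible_cylinder_list:
  assumes "finite J" "\<And>t. t \<in> J \<Longrightarrow> s < t" "\<And>t. A t \<in> sets borel"
  shows "admissible s (cylinder_list J A)"
  using assms by (auto simp: admissible_def cylinder_list_def o_def)

context borel_right_process
begin

lemma P_measurable: "0 \<le> t \<Longrightarrow> P t \<in> borel \<rightarrow>\<^sub>M subprob_algebra borel"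
  using semigroup by (simp add: borel_semigroup_def)

lemma P_subprob: "0 \<le> t \<Longrightarrow> subprob_space (P t x)" and sets_P [simp]: "0 \<le> t \<Longrightarrow> sets (P t x) = sets borel"
  using measurable_space[OF P_measurable, of t x] by (auto simp: space_subprob_algebra)

lemma measurable_chain_term:
  assumes "admissible s ps" and H: "(\<lambda>(p, y). H p y) \<in> borel_measurable (N \<Otimes>\<^sub>M borel)"
  shows "(\<lambda>(p, x). chain_term P (H p) s x ps) \<in> borel_measurable (N \<Otimes>\<^sub>M borel)"
  using assms(1)
proof (induct ps arbitrary: s)
  case (Cons q ps)
  then have [measurable]: "snd q \<in> borel_measurable borel" by simp
  have s: "0 \<le> fst q - s" using Cons(2) by simp
  have [measurable]: "(\<lambda>(p, x). chain_term P (H p) (fst q) x ps) \<in> borel_measurable (N \<Otimes>\<^sub>M borel)"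
    using Cons by simp
  have [measurable]: "(\<lambda>z. chain_term P (H (fst (fst z))) (fst q) (snd z) ps)
      \<in> borel_measurable ((N \<Otimes>\<^sub>M borel) \<Otimes>\<^sub>M borel)"
    using measurable_compose[of "\<lambda>z. (fst (fst z), snd z)" "(N \<Otimes>\<^sub>M borel) \<Otimes>\<^sub>M borel" "N \<Otimes>\<^sub>M borel"
      "\<lambda>(p, x). chain_term P (H p) (fst q) x ps"] by simp
  have "(\<lambda>z. \<integral>\<^sup>+ y. snd q y * chain_term P (H (fst z)) (fst q) y ps \<partial>P (fst q - s) (snd z))
      \<in> borel_measurable (N \<Otimes>\<^sub>M borel)"
    by (rule nn_integral_measurable_subprob_algebra2[OF _ measurable_compose[OF measurable_snd P_measurable[OF s]]])
       measurable
  then show ?case by (simp add: split_beta')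
qed (use H in simp)

lemma measurable_chain_term_1:
  assumes "admissible s ps" and h [measurable]: "h \<in> borel_measurable borel"
  shows "(\<lambda>x. chain_term P h s x ps) \<in> borel_measurable borel"
proof -
  have "(\<lambda>(p, x). chain_term P ((\<lambda>_. h) p) s x ps) \<in> borel_measurable (count_space (UNIV :: unit set) \<Otimes>\<^sub>M borel)"
    by (rule measurable_chain_term[OF assms(1)]) measurable
  from measurable_compose[OF measurable_Pair1'[of "()"] this] show ?thesis by simp
qed

text \<open>
  Tonelli's theorem, applied to one transition after the other.
\<close>
lemma chain_term_nn_integral:
  assumes "admissible s ps" and \<nu>: "sigma_finite_measure \<nu>"
    and H: "(\<lambda>(p, y). H p y) \<in> borel_measurable (\<nu> \<Otimes>\<^sub>M borel)"
  shows "chain_term P (\<lambda>y. \<integral>\<^sup>+ v. H v y \<partial>\<nu>) s x ps = (\<integral>\<^sup>+ v. chain_term P (H v) s x ps \<partial>\<nu>)"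
  using assms(1)
proof (induct ps arbitrary: s x)
  case (Cons q ps)
  then have [measurable]: "snd q \<in> borel_measurable borel" by simp
  have s: "0 \<le> fst q - s" using Cons(2) by simp
  interpret Px: subprob_space "P (fst q - s) x" by (rule P_subprob[OF s])
  interpret pair_sigma_finite \<nu> "P (fst q - s) x"
    unfolding pair_sigma_finite_def using \<nu> Px.sigma_finite_measure_axioms by simp
  have eqs: "sets (\<nu> \<Otimes>\<^sub>M P (fst q - s) x) = sets (\<nu> \<Otimes>\<^sub>M borel)" using s by (intro sets_pair_measure_cong) auto
  have m [measurable]: "(\<lambda>(v, y). chain_term P (H v) (fst q) y ps) \<in> borel_measurable (\<nu> \<Otimes>\<^sub>M borel)"
    using Cons(2) by (intro measurable_chain_term H) simp
  have "(\<integral>\<^sup>+ y. snd q y * chain_term P (\<lambda>y. \<integral>\<^sup>+ v. H v y \<partial>\<nu>) (fst q) y ps \<partial>P (fst q - s) x)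
      = (\<integral>\<^sup>+ y. snd q y * (\<integral>\<^sup>+ v. chain_term P (H v) (fst q) y ps \<partial>\<nu>) \<partial>P (fst q - s) x)"
    using Cons by (intro nn_integral_cong) simp
  also have "\<dots> = (\<integral>\<^sup>+ y. (\<integral>\<^sup>+ v. snd q y * chain_term P (H v) (fst q) y ps \<partial>\<nu>) \<partial>P (fst q - s) x)"
    by (intro nn_integral_cong nn_integral_cmult[symmetric])
       (rule measurable_Pair_compose_split[OF m], auto)
  also have "\<dots> = (\<integral>\<^sup>+ v. (\<integral>\<^sup>+ y. snd q y * chain_term P (H v) (fst q) y ps \<partial>P (fst q - s) x) \<partial>\<nu>)"
    by (rule Fubini') (subst measurable_cong_sets[OF eqs refl], measurable)
  finally show ?case by simp
qed simp

text \<open>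
  On a cylinder the law is a chain integral, which depends measurably on the starting point; the
  cylinders are closed under intersection and generate, so a Dynkin argument extends this to all events.
\<close>
lemma measurable_Px: "Px \<in> borel \<rightarrow>\<^sub>M subprob_algebra path_algebra"
proof (rule measurable_subprob_algebra_generated[OF sets_path_algebra_cylinders Int_stable_cylinders cylinders_subset])
  fix x
  interpret prob_space "Px x" by (rule Px_prob)
  show "subprob_space (Px x)" by (rule prob_space_imp_subprob_space) (rule Px_prob)
  show "sets (Px x) = sets path_algebra" by (rule sets_Px)
next
  have "emeasure (Px x) path_space = 1" for x
    using prob_space.emeasure_space_1[OF Px_prob, of x] sets_eq_imp_space_eq[OF sets_Px, of x] by simp
  then show "(\<lambda>x. emeasure (Px x) path_space) \<in> borel_measurable borel" by simp
next
  fix C :: "(real \<Rightarrow> 'a option) set" assume "C \<in> cylinders"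
  then obtain J A where C: "C = cylinder J A" and J: "finite J" "J \<subseteq> {0..}" and A: "\<And>t. A t \<in> sets borel"
    by (auto simp: cylinders_def)
  have *: "emeasure (Px x) C = (\<integral>\<^sup>+ \<omega>. (\<Prod>(s, g)\<leftarrow>cylinder_list J A. ext0 g (\<omega> s)) \<partial>Px x)" for x
  proof -
    have "emeasure (Px x) C = (\<integral>\<^sup>+ \<omega>. indicator C \<omega> \<partial>Px x)"
      unfolding C by (simp add: sets_Px J A cylinder_in_sets)
    also have "\<dots> = (\<integral>\<^sup>+ \<omega>. (\<Prod>(s, g)\<leftarrow>cylinder_list J A. ext0 g (\<omega> s)) \<partial>Px x)"
      unfolding C by (intro nn_integral_cong indicator_cylinder J) (simp add: sets_eq_imp_space_eq[OF sets_Px])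
    finally show ?thesis .
  qed
  show "(\<lambda>x. emeasure (Px x) C) \<in> borel_measurable borel"
  proof (cases "sorted_list_of_set J")
    case Nil
    then have "emeasure (Px x) C = 1" for x
      using * prob_space.emeasure_space_1[OF Px_prob, of x] by (simp add: cylinder_list_def)
    then show ?thesis by simp
  next
    case (Cons t ts)
    define ps where "ps = map (\<lambda>t. (t, indicator (A t) :: 'a \<Rightarrow> ennreal)) ts"
    have L: "cylinder_list J A = (t, indicator (A t)) # ps"
      by (simp add: cylinder_list_def Cons ps_def)
    have t: "0 \<le> t" using J Cons by (metis atLeast_iff list.set_intros(1) set_sorted_list_of_set subsetD)
    have sorted: "sorted_wrt (<) (t # ts)"
      using strict_sorted_list_of_set[of J] Cons by simp
    have adm: "admissible t ps" using sorted A by (auto simp: admissible_def ps_def o_def)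
    have "emeasure (Px x) C = (\<integral>\<^sup>+ y. indicator (A t) y * chain_int P t y ps \<partial>P t x)" for x
    proof -
      have "markov_law (Px x) {0..} (\<lambda>t. P t x) P" by (rule Px_markov)
      then show ?thesis unfolding * L markov_law_def
        using t sorted A by (elim allE[of _ t] allE[of _ "indicator (A t)"] allE[of _ ps])
          (auto simp: ps_def o_def)
    qed
    moreover have "(\<lambda>x. \<integral>\<^sup>+ y. indicator (A t) y * chain_int P t y ps \<partial>P t x) \<in> borel_measurable borel"
    proof -
      have [measurable]: "(\<lambda>y. chain_term P (\<lambda>_. 1) t y ps) \<in> borel_measurable borel"
        using adm by (rule measurable_chain_term_1) simp
      note [measurable] = A
      show ?thesis unfolding chain_int_eq_chain_term
        by (rule nn_integral_measurable_subprob_algebra2[OF _ P_measurable[OF t]]) measurable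
    qed
    ultimately show ?thesis by simp
  qed
qed

lemma Px_coordinate:
  assumes t: "0 \<le> t" and [measurable]: "g \<in> borel_measurable borel"
  shows "(\<integral>\<^sup>+ \<omega>. ext0 g (\<omega> t) \<partial>Px x) = (\<integral>\<^sup>+ y. g y \<partial>P t x)"
proof -
  have "markov_law (Px x) {0..} (\<lambda>t. P t x) P" by (rule Px_markov)
  then show ?thesis unfolding markov_law_def
    using assms by (elim allE[of _ t] allE[of _ g] allE[of _ "[]"]) auto
qed

text \<open>
  The semigroup is given as a kernel for each single time. Measurability jointly in time and starting
  point comes from the paths: \<open>P\<^sub>t(x,A)\<close> is the \<open>Px x\<close>-integral of a jointly measurable function of
  \<open>t\<close> and the path. It is what permits integration over time.
\<close>
lemma measurable_P_joint:
  "(\<lambda>(t, x). P (max 0 t) x) \<in> borel \<Otimes>\<^sub>M borel \<rightarrow>\<^sub>M subprob_algebra borel"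
proof (rule measurable_subprob_algebra)
  fix A :: "'a set" assume [measurable]: "A \<in> sets borel"
  note [measurable] = measurable_Px
  have [measurable]: "(\<lambda>z. snd z (max 0 (fst (fst z))) :: 'a option) \<in> ((borel :: real measure) \<Otimes>\<^sub>M (borel :: 'a measure)) \<Otimes>\<^sub>M path_algebra \<rightarrow>\<^sub>M state_algebra"
    by (rule measurable_evaluate[OF state_space, where f = "\<lambda>z. snd z" and g = "\<lambda>z. max 0 (fst (fst z))"]) auto
  have "(\<lambda>z. \<integral>\<^sup>+ \<omega>. ext0 (indicator A) (\<omega> (max 0 (fst z))) \<partial>Px (snd z)) \<in> borel_measurable (borel \<Otimes>\<^sub>M borel)"
    by (rule nn_integral_measurable_subprob_algebra2[where N = path_algebra]) measurable
  then show "(\<lambda>a. emeasure (case a of (t, x) \<Rightarrow> P (max 0 t) x) A) \<in> borel_measurable (borel \<Otimes>\<^sub>M borel)"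
    by (simp add: Px_coordinate split_beta')
qed (auto simp: split_beta' P_subprob)

end


section \<open>Potential densities and the measures \<open>Q\<^sup>z\<^sup>,\<^sup>z\<close>\<close>

text \<open>
  The basic open sets contained in some compact set are countably many and cover the space.
\<close>
lemma compact_exhaustion:
  assumes lc: "locally_compact_space (euclidean :: 'a topology)"
  obtains K :: "nat \<Rightarrow> 'a::{second_countable_topology, t2_space} set" where "\<And>n. compact (K n)" "incseq K" "(\<Union>n. K n) = UNIV"
proof -
  obtain B :: "'a set set" where B: "countable B" "topological_basis B" using ex_countable_basis by auto
  define S where "S = {b \<in> B. \<exists>K. compact K \<and> b \<subseteq> K}"
  define C where "C b = (SOME K. compact K \<and> b \<subseteq> K)" for b :: "'a set"
  have C: "compact (C b) \<and> b \<subseteq> C b" if "b \<in> S" for b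
  proof -
    have "\<exists>K. compact K \<and> b \<subseteq> K" using that by (auto simp: S_def)
    then show ?thesis unfolding C_def by (rule someI_ex)
  qed
  have cover: "\<exists>b\<in>S. x \<in> b" for x
  proof -
    obtain U L where UL: "open U" "compact L" "x \<in> U" "U \<subseteq> L"
      using lc unfolding locally_compact_space_def by simp metis
    obtain b where "b \<in> B" "x \<in> b" "b \<subseteq> U" using topological_basisE[OF B(2) UL(1,3)] by auto
    then show ?thesis using UL by (auto simp: S_def)
  qed
  then have S: "S \<noteq> {}" "countable S" using B by (blast, auto simp: S_def)
  define K where "K n = (\<Union>i\<le>n. C (from_nat_into S i))" for n :: nat
  show ?thesis
  proof (rule that[of K])
    show "compact (K n)" for n
      unfolding K_def using C from_nat_into[OF S(1)] by (intro compact_UN) auto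
    show "incseq K" unfolding K_def by (auto simp: incseq_def intro: order_trans)
    have "x \<in> (\<Union>n. K n)" for x
    proof -
      obtain b where b: "b \<in> S" "x \<in> b" using cover by auto
      then obtain i where "from_nat_into S i = b" using from_nat_into_surj[OF S(2)] by auto
      then have "x \<in> K i" using C b by (auto simp: K_def)
      then show ?thesis by auto
    qed
    then show "(\<Union>n. K n) = UNIV" by auto
  qed
qed

lemma (in borel_right_process) chain_term_0: "chain_term P (\<lambda>_. 0) s x ps = 0"
  by (induct ps arbitrary: s x) simp_all

lemma (in borel_right_process) chain_term_cmult:
  assumes "admissible s ps" and h [measurable]: "h \<in> borel_measurable borel"
  shows "chain_term P (\<lambda>y. c * h y) s x ps = c * chain_term P h s x ps"
  using assms(1)
proof (induct ps arbitrary: s x)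
  case (Cons q ps)
  then have [measurable]: "snd q \<in> borel_measurable borel"
    "(\<lambda>y. chain_term P h (fst q) y ps) \<in> borel_measurable borel"
    by (auto intro: measurable_chain_term_1)
  have "(\<lambda>y. snd q y * chain_term P h (fst q) y ps) \<in> borel_measurable (P (fst q - s) x)"
    using Cons(2) by (subst measurable_cong_sets[OF sets_P refl]) auto
  from nn_integral_cmult[OF this, of c] show ?case
    using Cons by (simp add: mult.left_commute)
qed simp

context loop_setting
begin

lemma sigma_finite_m: "sigma_finite_measure m"
proof -
  obtain K :: "nat \<Rightarrow> 'a set" where K: "\<And>n. compact (K n)" "incseq K" "(\<Union>n. K n) = UNIV"
    using compact_exhaustion[OF state_space] by metis
  show ?thesis
  proof
    show "\<exists>A. countable A \<and> A \<subseteq> sets m \<and> \<Union>A = space m \<and> (\<forall>a\<in>A. emeasure m a \<noteq> \<infinity>)"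
      using K m_compact by (intro exI[of _ "range K"])
        (auto simp: sets_m sets_eq_imp_space_eq[OF sets_m] borel_compact less_top[symmetric])
  qed
qed

lemma P_singleton: assumes "0 < t" shows "emeasure (P t x) {z} = 0"
proof -
  have "emeasure (P t x) {z} = (\<integral>\<^sup>+ y. indicator {z} y \<partial>P t x)"
    using assms by (simp)
  also have "\<dots> = (\<integral>\<^sup>+ \<omega>. ext0 (indicator {z}) (\<omega> t) \<partial>Px x)"
    using assms by (subst Px_coordinate) auto
  also have "\<dots> = (\<integral>\<^sup>+ \<omega>. 0 \<partial>Px x)"
  proof (rule nn_integral_cong_AE)
    have "AE \<omega> in Px x. hitting_time (Some ` {z}) \<omega> = \<infinity>"
      using points_polar[of z] by (simp add: polar_def)
    then show "AE \<omega> in Px x. ext0 (indicator {z}) (\<omega> t) = 0"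
    proof eventually_elim
      case (elim \<omega>)
      have "\<omega> t \<noteq> Some z"
      proof
        assume "\<omega> t = Some z"
        then have "hitting_time (Some ` {z}) \<omega> \<le> ennreal t"
          unfolding hitting_time_def using assms by (intro INF_lower) auto
        with elim show False by (simp add: top_unique)
      qed
      then show ?case by (cases "\<omega> t") (auto simp: ext0_def)
    qed
  qed
  finally show ?thesis by simp
qed

lemma AE_P_finite: assumes "0 < t" shows "AE y in P t x. u 0 y z < \<infinity>"
proof (rule AE_I[of _ _ "{z}"])
  show "{y \<in> space (P t x). \<not> u 0 y z < \<infinity>} \<subseteq> {z}" using u_off_diagonal by blast
  show "emeasure (P t x) {z} = 0" by (rule P_singleton[OF assms])
  show "{z} \<in> sets (P t x)" using assms by simp
qed

lemma u_measurable_1 [measurable]: "(\<lambda>x. u 0 x z) \<in> borel_measurable borel"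
  using u_excessive by (simp add: alpha_excessive_def)

lemma u_measurable_2 [measurable]: "(\<lambda>y. u 0 x y) \<in> borel_measurable borel"
  using measurable_compose[OF measurable_Pair1'[of x] u_measurable[of 0]] by simp

text \<open>
  The density assumption says this for indicators, hence it is an equality of two measures in \<open>y\<close>.
  Time \<open>0\<close> is left out, at the cost of a null set, because the times at which a loop is cut come
  strictly after the previous time of observation.
\<close>
lemma potential_operator:
  assumes [measurable]: "\<phi> \<in> borel_measurable borel"
  shows "(\<integral>\<^sup>+ t. indicator {0<..} t * (\<integral>\<^sup>+ y. \<phi> y \<partial>P (max 0 t) x) \<partial>lborel) = (\<integral>\<^sup>+ y. u 0 x y * \<phi> y \<partial>m)"
proof -
  note [measurable_cong] = sets_m
  let ?L = "density lborel (indicator {0..})"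
  let ?B = "?L \<bind> (\<lambda>t. P (max 0 t) x)"
  have k: "(\<lambda>t. P (max 0 t) x) \<in> ?L \<rightarrow>\<^sub>M subprob_algebra borel"
    using measurable_compose[OF measurable_Pair2'[of x borel] measurable_P_joint] by simp
  have nB: "(\<integral>\<^sup>+ y. g y \<partial>?B) = (\<integral>\<^sup>+ t. indicator {0..} t * (\<integral>\<^sup>+ y. g y \<partial>P (max 0 t) x) \<partial>lborel)"
    if [measurable]: "g \<in> borel_measurable borel" for g
  proof -
    have "(\<lambda>t. \<integral>\<^sup>+ y. g y \<partial>P (max 0 t) x) \<in> borel_measurable ?L"
      using measurable_compose[OF k nn_integral_measurable_subprob_algebra] by simp
    then show ?thesis unfolding nn_integral_bind[OF that k] by (subst nn_integral_density) auto
  qed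
  have sB: "sets ?B = sets borel" by (rule sets_bind[OF sets_kernel[OF k]]) auto
  have "?B = density m (u 0 x)"
  proof (rule measure_eqI)
    fix A assume "A \<in> sets ?B"
    then have A [measurable]: "A \<in> sets borel" using sB by simp
    have "emeasure ?B A = (\<integral>\<^sup>+ y. indicator A y \<partial>?B)" using A sB by simp
    also have "\<dots> = (\<integral>\<^sup>+ t. indicator {0..} t * (\<integral>\<^sup>+ y. indicator A y \<partial>P (max 0 t) x) \<partial>lborel)" by (rule nB) auto
    also have "\<dots> = (\<integral>\<^sup>+ t\<in>{0..}. ennreal (exp (- 0 * t)) * emeasure (P t x) A \<partial>lborel)"
    proof (rule nn_integral_cong)
      fix t :: real
      show "indicator {0..} t * (\<integral>\<^sup>+ y. indicator A y \<partial>P (max 0 t) x)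
          = ennreal (exp (- 0 * t)) * emeasure (P t x) A * indicator {0..} t"
        by (cases "0 \<le> t") (auto simp: max_absorb2)
    qed
    also have "\<dots> = (\<integral>\<^sup>+ y\<in>A. u 0 x y \<partial>m)" by (rule u_density) auto
    also have "\<dots> = emeasure (density m (u 0 x)) A" by (subst emeasure_density) (auto simp: sets_m)
    finally show "emeasure ?B A = emeasure (density m (u 0 x)) A" .
  qed (simp add: sB sets_m)
  then have "(\<integral>\<^sup>+ t. indicator {0..} t * (\<integral>\<^sup>+ y. \<phi> y \<partial>P (max 0 t) x) \<partial>lborel) = (\<integral>\<^sup>+ y. u 0 x y * \<phi> y \<partial>m)"
    by (simp add: nB[symmetric] nn_integral_density)
  moreover have "AE t in lborel. t \<noteq> (0::real)" by (rule AE_lborel_singleton)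
  then have "(\<integral>\<^sup>+ t. indicator {0<..} t * (\<integral>\<^sup>+ y. \<phi> y \<partial>P (max 0 t) x) \<partial>lborel) =
     (\<integral>\<^sup>+ t. indicator {0..} t * (\<integral>\<^sup>+ y. \<phi> y \<partial>P (max 0 t) x) \<partial>lborel)"
    by (intro nn_integral_cong_AE) (auto simp: indicator_def)
  ultimately show ?thesis by simp
qed

lemma ennreal_mult_divide_cancel: "0 < a \<Longrightarrow> a < \<infinity> \<Longrightarrow> a * (b / a) = (b :: ennreal)"
  by (metis ennreal_divide_self ennreal_times_divide infinity_ennreal_def mult.commute mult.right_neutral
      not_gr_zero)

text \<open>
  The factors \<open>h(y) / h(x)\<close> of consecutive transitions telescope, leaving \<open>h\<close> at the last state.
  Cancellation fails where \<open>h\<close> is infinite, that is at \<open>z\<close>, but \<open>z\<close> is polar and is not charged by any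
  transition. Measurability is carried through the same induction because integration against the
  density of the next transition requires it.
\<close>
lemma h_transform_chain_aux:
  assumes "admissible s ps"
  shows "(\<lambda>x. chain_int (h_transform (\<lambda>x. u 0 x z) P) s x ps) \<in> borel_measurable borel \<and>
    (\<forall>x. u 0 x z < \<infinity> \<longrightarrow>
      u 0 x z * chain_int (h_transform (\<lambda>x. u 0 x z) P) s x ps = chain_term P (\<lambda>x. u 0 x z) s x ps)"
  using assms
proof (induct ps arbitrary: s)
  case (Cons q ps)
  let ?h = "\<lambda>x. u 0 x z"
  let ?C = "\<lambda>y. chain_int (h_transform ?h P) (fst q) y ps"
  from Cons have [measurable]: "?C \<in> borel_measurable borel" "snd q \<in> borel_measurable borel"
    and IH: "\<And>x. ?h x < \<infinity> \<Longrightarrow> ?h x * ?C x = chain_term P ?h (fst q) x ps" and t: "0 < fst q - s"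
    by auto
  have eqs: "measurable (P (fst q - s) x) borel = measurable borel (borel :: ennreal measure)" for x
    using t by (intro measurable_cong_sets) auto
  have step: "chain_int (h_transform ?h P) s x (q # ps)
      = (\<integral>\<^sup>+ y. ?h y / ?h x * (snd q y * ?C y) \<partial>P (fst q - s) x)" for x
  proof -
    have "chain_int (h_transform ?h P) s x (q # ps)
        = (\<integral>\<^sup>+ y. snd q y * ?C y \<partial>density (P (fst q - s) x) (\<lambda>y. ?h y / ?h x))"
      by (simp add: h_transform_def[of _ P "fst q - s" x])
    then show ?thesis by (simp add: nn_integral_density eqs)
  qed
  have "(\<lambda>x. \<integral>\<^sup>+ y. ?h y / ?h x * (snd q y * ?C y) \<partial>P (fst q - s) x) \<in> borel_measurable borel"
    using t by (intro nn_integral_measurable_subprob_algebra2[OF _ P_measurable]) auto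
  moreover have "?h x * (\<integral>\<^sup>+ y. ?h y / ?h x * (snd q y * ?C y) \<partial>P (fst q - s) x)
      = chain_term P ?h s x (q # ps)" if x: "?h x < \<infinity>" for x
  proof -
    have "?h x * (\<integral>\<^sup>+ y. ?h y / ?h x * (snd q y * ?C y) \<partial>P (fst q - s) x)
        = (\<integral>\<^sup>+ y. ?h x * (?h y / ?h x * (snd q y * ?C y)) \<partial>P (fst q - s) x)"
      by (rule nn_integral_cmult[symmetric]) (simp add: eqs)
    also have "\<dots> = (\<integral>\<^sup>+ y. snd q y * chain_term P ?h (fst q) y ps \<partial>P (fst q - s) x)"
      using AE_P_finite[OF t, of z x]
    proof (intro nn_integral_cong_AE, eventually_elim)
      fix y assume y: "?h y < \<infinity>"
      have "?h x * (?h y / ?h x * (snd q y * ?C y)) = (?h x * (?h y / ?h x)) * (snd q y * ?C y)"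
        by (simp only: mult.assoc)
      also have "\<dots> = snd q y * (?h y * ?C y)"
        using ennreal_mult_divide_cancel[OF u_pos x] by (simp add: mult.left_commute)
      finally show "?h x * (?h y / ?h x * (snd q y * ?C y)) = snd q y * chain_term P ?h (fst q) y ps"
        by (simp add: IH[OF y])
    qed
    finally show ?thesis by simp
  qed
  ultimately show ?case unfolding step by blast
qed auto

lemmas h_transform_chain_measurable = h_transform_chain_aux[THEN conjunct1]
lemmas h_transform_chain = h_transform_chain_aux[THEN conjunct2, rule_format]

text \<open>
  The entrance law contributes the factor \<open>h\<close> at the first state, which cancels the remaining
  denominator.
\<close>
lemma Q_chain:
  assumes Q: "is_Qzz P u z M" and ps: "admissible 0 ps" "ps \<noteq> []"
  shows "(\<integral>\<^sup>+ \<omega>. (\<Prod>(s, g)\<leftarrow>ps. ext0 g (\<omega> s)) \<partial>M) = chain_term P (\<lambda>x. u 0 x z) 0 z ps"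
proof -
  let ?h = "\<lambda>x. u 0 x z"
  obtain t f qs where ps_eq: "ps = (t, f) # qs" using ps(2) by (cases ps) auto
  have t: "0 < t" and [measurable]: "f \<in> borel_measurable borel" and qs: "admissible t qs"
    using ps(1) by (auto simp: ps_eq)
  note sets_P[measurable_cong]
  have eqs: "measurable (P t z) borel = measurable borel (borel :: ennreal measure)"
    using t by (intro measurable_cong_sets) auto
  have C: "(\<lambda>x. chain_int (h_transform ?h P) t x qs) \<in> borel_measurable borel"
    by (rule h_transform_chain_measurable[OF qs])
  have "markov_law M {0<..} (entrance_law ?h P z) (h_transform ?h P)"
    using Q by (simp add: is_Qzz_def)
  moreover have "sorted_wrt (<) (map fst ((t, f) # qs))" "\<forall>g\<in>snd ` set ((t, f) # qs). g \<in> borel_measurable borel"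
    using qs by (auto simp: admissible_def)
  ultimately have "(\<integral>\<^sup>+ \<omega>. (\<Prod>(s, g)\<leftarrow>ps. ext0 g (\<omega> s)) \<partial>M) =
      (\<integral>\<^sup>+ x. f x * chain_int (h_transform ?h P) t x qs \<partial>entrance_law ?h P z t)"
    using t unfolding markov_law_def ps_eq by blast
  also have "\<dots> = (\<integral>\<^sup>+ x. ?h x * (f x * chain_int (h_transform ?h P) t x qs) \<partial>P t z)"
    unfolding entrance_law_def using C by (intro nn_integral_density) (auto simp: eqs)
  also have "\<dots> = (\<integral>\<^sup>+ x. f x * chain_term P ?h t x qs \<partial>P t z)"
    using AE_P_finite[OF t, of z z]
    by (intro nn_integral_cong_AE, eventually_elim)
       (simp add: h_transform_chain[OF qs, symmetric] mult.left_commute)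
  finally show ?thesis by (simp add: ps_eq)
qed

text \<open>
  The mass of the paths that are at time \<open>t\<close> in \<open>{x. u(x,z) \<le> n}\<close> is the \<open>P\<^sub>t(z,\<cdot>)\<close>-integral of \<open>u(\<cdot>,z)\<close>
  over this set, hence at most \<open>n\<close>. These sets leave out only the state \<open>z\<close>, which carries no mass, and
  every path with positive lifetime is alive at one of the times \<open>1 / (k + 1)\<close>.
\<close>
lemma sigma_finite_Q:
  assumes Q: "is_Qzz P u z M"
  shows "sigma_finite_measure M"
proof
  have sM: "sets M = sets path_algebra" and spM: "space M = path_space"
    using Q sets_eq_imp_space_eq[of M path_algebra] by (auto simp: is_Qzz_def)
  let ?T = "\<lambda>k::nat. 1 / (real k + 1)"
  let ?I = "\<lambda>n::nat. {x. u 0 x z \<le> of_nat n}"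
  have t: "0 < ?T k" for k by simp
  have coord: "{\<omega> \<in> path_space. \<omega> (?T k) \<in> Some ` A} \<in> sets M" if "A \<in> sets borel" for A k
  proof -
    have "(\<lambda>\<omega>. \<omega> (?T k)) -` (Some ` A) \<inter> space path_algebra \<in> sets path_algebra"
      using that by (intro measurable_sets[OF measurable_coordinate] Some_image_in_state_algebra) auto
    then show ?thesis by (simp add: sM vimage_def Int_def conj_commute)
  qed
  have em: "emeasure M {\<omega> \<in> path_space. \<omega> (?T k) \<in> Some ` A} = (\<integral>\<^sup>+ x. indicator A x * u 0 x z \<partial>P (?T k) z)"
    if A: "A \<in> sets borel" for A k
  proof -
    have "emeasure M {\<omega> \<in> path_space. \<omega> (?T k) \<in> Some ` A}
        = (\<integral>\<^sup>+ \<omega>. indicator {\<omega> \<in> path_space. \<omega> (?T k) \<in> Some ` A} \<omega> \<partial>M)"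
      using coord[OF A] by simp
    also have "\<dots> = (\<integral>\<^sup>+ \<omega>. (\<Prod>(s, g)\<leftarrow>[(?T k, indicator A)]. ext0 g (\<omega> s)) \<partial>M)"
      by (intro nn_integral_cong)
         (auto simp: spM ext0_def indicator_def split: option.splits)
    also have "\<dots> = chain_term P (\<lambda>x. u 0 x z) 0 z [(?T k, indicator A)]"
      using A by (intro Q_chain[OF Q]) auto
    finally show ?thesis by simp
  qed
  have I [measurable]: "?I n \<in> sets borel" for n by measurable
  have fin: "emeasure M {\<omega> \<in> path_space. \<omega> (?T k) \<in> Some ` ?I n} \<noteq> \<infinity>" for k n
  proof -
    interpret subprob_space "P (?T k) z" by (rule P_subprob) simp
    have "(\<integral>\<^sup>+ x. indicator (?I n) x * u 0 x z \<partial>P (?T k) z) \<le> (\<integral>\<^sup>+ x. of_nat n \<partial>P (?T k) z)"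
      by (intro nn_integral_mono) (auto simp: indicator_def)
    also have "\<dots> = of_nat n * emeasure (P (?T k) z) (space (P (?T k) z))" by simp
    also have "\<dots> < \<infinity>" by (simp add: less_top[symmetric] ennreal_mult_eq_top_iff emeasure_eq_measure)
    finally show ?thesis using em[OF I] by (simp add: less_top)
  qed
  \<comment> \<open>the only state left out by the sets above\<close>
  have sing: "emeasure M {\<omega> \<in> path_space. \<omega> (?T k) \<in> Some ` {z}} \<noteq> \<infinity>" for k
  proof -
    have "AE x in P (?T k) z. indicator {z} x * u 0 x z = 0"
      by (rule AE_I[of _ _ "{z}"]) (auto simp: P_singleton split: split_indicator)
    then have "(\<integral>\<^sup>+ x. indicator {z} x * u 0 x z \<partial>P (?T k) z) = (\<integral>\<^sup>+ x. 0 \<partial>P (?T k) z)"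
      by (rule nn_integral_cong_AE)
    then show ?thesis using em[of "{z}" k] by simp
  qed
  have Z: "{\<omega> \<in> path_space. \<not> 0 < lifetime \<omega>} \<in> sets M"
  proof -
    have "{\<omega> \<in> space path_algebra. \<not> 0 < lifetime \<omega>} \<in> sets path_algebra" by measurable
    then show ?thesis by (simp add: sM)
  qed
  have "AE \<omega> in M. \<not> \<not> 0 < lifetime \<omega>" using Q by (auto simp: is_Qzz_def)
  \<comment> \<open>paths that are never alive after time \<open>0\<close> are missed by all times \<open>1 / (k + 1)\<close>\<close>
  then have Z0: "emeasure M {\<omega> \<in> path_space. \<not> 0 < lifetime \<omega>} = 0"
    using Z by (subst (asm) AE_iff_measurable[OF Z]) (auto simp: spM)
  let ?A = "insert {\<omega> \<in> path_space. \<not> 0 < lifetime \<omega>}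
    (range (\<lambda>k. {\<omega> \<in> path_space. \<omega> (?T k) \<in> Some ` {z}}) \<union>
     range (\<lambda>(k, n). {\<omega> \<in> path_space. \<omega> (?T k) \<in> Some ` ?I n}))"
  have "\<omega> \<in> \<Union>?A" if \<omega>: "\<omega> \<in> path_space" for \<omega>
  proof (cases "0 < lifetime \<omega>")
    case True
    obtain k where k: "ennreal (?T k) < lifetime \<omega>"
    proof (cases "lifetime \<omega>")
      case (real r)
      then obtain k where "?T k < r" using True reals_Archimedean[of r] by (auto simp: inverse_eq_divide add.commute)
      then show ?thesis using that[of k] real by (auto simp: ennreal_less_iff)
    qed (auto intro: that[of 0])
    then obtain x where x: "\<omega> (?T k) = Some x" using path_None_iff[OF \<omega>, of "?T k"] by (cases "\<omega> (?T k)") auto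
    show ?thesis
    proof (cases "x = z")
      case True then show ?thesis using x \<omega> by auto
    next
      case False
      then obtain n where "u 0 x z < of_nat n"
        using u_off_diagonal[OF False] ennreal_Ex_less_of_nat by auto
      then have "\<omega> \<in> {\<omega> \<in> path_space. \<omega> (?T k) \<in> Some ` ?I n}" using x \<omega> by auto
      then show ?thesis by (intro UnionI[of "{\<omega> \<in> path_space. \<omega> (?T k) \<in> Some ` ?I n}"]) auto
    qed
  qed (use \<omega> in auto)
  then have "path_space \<subseteq> \<Union>?A" by (rule subsetI)
  moreover have "\<Union>?A \<subseteq> path_space" by auto
  ultimately have "\<Union>?A = space M" unfolding spM by (rule subset_antisym[rotated])
  moreover have "?A \<subseteq> sets M" using coord[OF I] coord[of "{z}"] Z by auto
  moreover have "\<forall>a\<in>?A. emeasure M a \<noteq> \<infinity>" using fin sing Z0 by auto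
  moreover have "countable ?A" by simp
  ultimately show "\<exists>A. countable A \<and> A \<subseteq> sets M \<and> \<Union>A = space M \<and> (\<forall>a\<in>A. emeasure M a \<noteq> \<infinity>)" by blast
qed

end


section \<open>The joint law of the two arcs of a cut loop\<close>

lemma borel_measurable_prod_list_ennreal:
  fixes F :: "'p \<Rightarrow> 'b \<Rightarrow> ennreal"
  assumes "\<And>p. p \<in> set ps \<Longrightarrow> F p \<in> borel_measurable N"
  shows "(\<lambda>x. \<Prod>p\<leftarrow>ps. F p x) \<in> borel_measurable N"
  using assms by (induct ps) auto

lemma le_last_of_sorted: "sorted_wrt (<) xs \<Longrightarrow> (x::real) \<in> set xs \<Longrightarrow> x \<le> last xs"
  by (induct xs) (auto simp: less_imp_le)

text \<open>
  Clamping at \<open>0\<close> keeps the operation defined, and jointly measurable, on the whole real line of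
  cutting times; negative ones receive no weight below.
\<close>
definition cut_path :: "(real \<Rightarrow> 'a option) \<times> real \<Rightarrow> (real \<Rightarrow> 'a option) \<times> (real \<Rightarrow> 'a option)" where
  "cut_path = (\<lambda>(\<omega>, v). (kill_path (max 0 v) \<omega>, shift_path (max 0 v) \<omega>))"

text \<open>
  Selects the loops that start in \<open>K\<close> and are cut at a positive time while they are in \<open>K\<close>. Since
  \<^const>\<open>ext0\<close> vanishes at the cemetery, the cutting time is then smaller than the lifetime.
\<close>
definition marked :: "'a set \<Rightarrow> (real \<Rightarrow> 'a option) \<times> real \<Rightarrow> ennreal" where
  "marked K = (\<lambda>(\<omega>, v). indicator {0<..} v * ext0 (indicator K) (\<omega> 0) * ext0 (indicator K) (\<omega> (max 0 v)))"

text \<open>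
  The joint law of the two arcs when a path with law \<open>M\<close> is cut at a time distributed according to
  Lebesgue measure. The constant \<open>c\<close> serves to turn this into a subprobability.
\<close>
definition pair_law :: "ennreal \<Rightarrow> 'a set \<Rightarrow> (real \<Rightarrow> 'a::topological_space option) measure \<Rightarrow>
    ((real \<Rightarrow> 'a option) \<times> (real \<Rightarrow> 'a option)) measure" where
  "pair_law c K M = distr (density (M \<Otimes>\<^sub>M lborel) (\<lambda>x. c * marked K x)) (path_algebra \<Otimes>\<^sub>M path_algebra) cut_path"

context borel_right_process
begin

lemma measurable_coordinate_pair:
  assumes g: "g \<in> borel_measurable borel" and a: "0 \<le> a"
  shows "(\<lambda>x :: (real \<Rightarrow> 'a option) \<times> real. ext0 g (fst x (max 0 (snd x) + a)))
      \<in> borel_measurable (path_algebra \<Otimes>\<^sub>M lborel)"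
proof (rule measurable_compose[OF _ measurable_ext0[OF g]])
  show "(\<lambda>x :: (real \<Rightarrow> 'a option) \<times> real. fst x (max 0 (snd x) + a)) \<in> path_algebra \<Otimes>\<^sub>M lborel \<rightarrow>\<^sub>M state_algebra"
    using a by (intro measurable_evaluate[OF state_space, where f = fst and g = "\<lambda>x. max 0 (snd x) + a"]) auto
qed

lemma measurable_coordinate_fst:
  assumes g: "g \<in> borel_measurable borel" and a: "0 \<le> a"
  shows "(\<lambda>x :: (real \<Rightarrow> 'a option) \<times> real. ext0 g (fst x a)) \<in> borel_measurable (path_algebra \<Otimes>\<^sub>M lborel)"
  by (rule measurable_compose[OF measurable_compose[OF measurable_fst measurable_coordinate[OF a]] measurable_ext0[OF g]])

lemma measurable_cut_path:
  "(cut_path :: (real \<Rightarrow> 'a option) \<times> real \<Rightarrow> _) \<in> path_algebra \<Otimes>\<^sub>M lborel \<rightarrow>\<^sub>M path_algebra \<Otimes>\<^sub>M path_algebra"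
proof -
  let ?N = "path_algebra \<Otimes>\<^sub>M lborel :: ((real \<Rightarrow> 'a option) \<times> real) measure"
  have "(\<lambda>x. kill_path (max 0 (snd x)) (fst x)) \<in> ?N \<rightarrow>\<^sub>M path_algebra"
    by (rule measurable_kill_path[OF state_space, where f = fst and g = "\<lambda>x. max 0 (snd x)"]) auto
  moreover have "(\<lambda>x. shift_path (max 0 (snd x)) (fst x)) \<in> ?N \<rightarrow>\<^sub>M path_algebra"
    by (rule measurable_shift_path[OF state_space, where f = fst and g = "\<lambda>x. max 0 (snd x)"]) auto
  ultimately show ?thesis unfolding cut_path_def split_beta' by (rule measurable_Pair)
qed

lemma measurable_marked:
  assumes "K \<in> sets borel"
  shows "marked (K :: 'a set) \<in> borel_measurable (path_algebra \<Otimes>\<^sub>M lborel)"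
proof -
  have [measurable]: "(\<lambda>x :: (real \<Rightarrow> 'a option) \<times> real. ext0 (indicator K) (fst x (max 0 (snd x))))
      \<in> borel_measurable (path_algebra \<Otimes>\<^sub>M lborel)"
    using measurable_coordinate_pair[of "indicator K" 0] assms by simp
  have [measurable]: "(\<lambda>x :: (real \<Rightarrow> 'a option) \<times> real. ext0 (indicator K) (fst x 0))
      \<in> borel_measurable (path_algebra \<Otimes>\<^sub>M lborel)"
    using measurable_coordinate_fst[of "indicator K" 0] assms by simp
  show ?thesis unfolding marked_def split_beta' by measurable
qed

lemma nn_integral_pair_law:
  fixes K :: "'a set"
  assumes M: "sets M = sets path_algebra" and K: "K \<in> sets borel"
    and f: "f \<in> borel_measurable (path_algebra \<Otimes>\<^sub>M path_algebra)"
  shows "(\<integral>\<^sup>+ p. f p \<partial>pair_law c K M) =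
    c * (\<integral>\<^sup>+ \<omega>. (\<integral>\<^sup>+ v. marked K (\<omega>, v) * f (cut_path (\<omega>, v)) \<partial>lborel) \<partial>M)"
proof -
  note [measurable_cong] = M
  have eq: "sets (M \<Otimes>\<^sub>M lborel) = sets (path_algebra \<Otimes>\<^sub>M lborel)" using M by (intro sets_pair_measure_cong) auto
  have [measurable]: "cut_path \<in> M \<Otimes>\<^sub>M lborel \<rightarrow>\<^sub>M path_algebra \<Otimes>\<^sub>M path_algebra"
    "marked K \<in> borel_measurable (M \<Otimes>\<^sub>M lborel)"
    using measurable_cut_path measurable_marked[OF K] by (simp_all add: measurable_cong_sets[OF eq refl])
  note [measurable] = f
  have "(\<integral>\<^sup>+ p. f p \<partial>pair_law c K M) = (\<integral>\<^sup>+ x. c * marked K x * f (cut_path x) \<partial>(M \<Otimes>\<^sub>M lborel))"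
    unfolding pair_law_def by (subst nn_integral_distr, simp, simp, subst nn_integral_density) auto
  also have "\<dots> = c * (\<integral>\<^sup>+ x. marked K x * f (cut_path x) \<partial>(M \<Otimes>\<^sub>M lborel))"
    by (subst nn_integral_cmult[symmetric]) (auto simp: mult.assoc)
  also have "(\<integral>\<^sup>+ x. marked K x * f (cut_path x) \<partial>(M \<Otimes>\<^sub>M lborel))
      = (\<integral>\<^sup>+ \<omega>. (\<integral>\<^sup>+ v. marked K (\<omega>, v) * f (cut_path (\<omega>, v)) \<partial>lborel) \<partial>M)"
    by (rule lborel.nn_integral_fst[symmetric]) measurable
  finally show ?thesis .
qed

end

context loop_setting
begin

text \<open>
  The weight of the arcs from \<open>x\<close> to \<open>y\<close> that belong to a cylinder set and start in \<open>K\<close>: the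
  finite-dimensional distribution under \<open>P\<close> of the positive times, closed up by the potential density
  from the last state to \<open>y\<close>. Time \<open>0\<close> is separate because the position there is deterministic.
\<close>
definition arc_weight :: "'a set \<Rightarrow> real set \<Rightarrow> (real \<Rightarrow> 'a set) \<Rightarrow> 'a \<Rightarrow> 'a \<Rightarrow> ennreal" where
  "arc_weight K J A x y = indicator (K \<inter> (if 0 \<in> J then A 0 else UNIV)) x *
     chain_term P (\<lambda>w. u 0 w y) 0 x (cylinder_list (J - {0}) A)"

lemma arc_weight_measurable:
  assumes "K \<in> sets borel" "finite J" "J \<subseteq> {0..}" "\<And>t. A t \<in> sets borel"
  shows "(\<lambda>(x, y). arc_weight K J A x y) \<in> borel_measurable (borel \<Otimes>\<^sub>M borel)"
proof -
  have "admissible 0 (cylinder_list (J - {0}) A)"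
    using assms by (intro admissible_cylinder_list) (auto simp: less_le)
  then have "(\<lambda>(y, x). chain_term P (\<lambda>w. u 0 w y) 0 x (cylinder_list (J - {0}) A)) \<in> borel_measurable (borel \<Otimes>\<^sub>M borel)"
  proof (rule measurable_chain_term)
    show "(\<lambda>(y, x). u 0 x y) \<in> borel_measurable (borel \<Otimes>\<^sub>M borel)"
      using measurable_pair_swap[OF u_measurable[of 0]] by (simp add: split_beta')
  qed
  from measurable_pair_swap[OF this]
  have [measurable]: "(\<lambda>z. chain_term P (\<lambda>w. u 0 w (snd z)) 0 (fst z) (cylinder_list (J - {0}) A)) \<in> borel_measurable (borel \<Otimes>\<^sub>M borel)"
    by (simp add: split_beta')
  have [measurable]: "(K \<inter> (if 0 \<in> J then A 0 else UNIV)) \<in> sets borel" using assms by auto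
  show ?thesis unfolding arc_weight_def split_beta' by measurable
qed

text \<open>
  For a path started at \<open>z\<close>, an event about both arcs is a product of conditions at the times of \<open>J\<close>,
  at \<open>v\<close>, and at the times of \<open>J'\<close> shifted by \<open>v\<close>. If \<open>v\<close> does not exceed the last time in \<open>J\<close>, the first
  arc is dead at that time and the event is empty; this produces the indicator, and it makes the
  combined list of times strictly increasing wherever the integrand does not vanish.
\<close>
lemma pair_law_integrand:
  fixes K :: "'a set"
  assumes J: "finite J" "J \<subseteq> {0..}" and J': "finite J'" "J' \<subseteq> {0..}"
    and \<omega>: "\<omega> \<in> path_space" "\<omega> 0 = Some z"
  shows "marked K (\<omega>, v) * indicator (cylinder J A \<times> cylinder J' B) (cut_path (\<omega>, v)) =
    indicator (K \<inter> (if 0 \<in> J then A 0 else UNIV)) z *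
    (indicator {last (0 # map fst (cylinder_list (J - {0}) A))<..} v *
     ((\<Prod>(s, g)\<leftarrow>cylinder_list (J - {0}) A. ext0 g (\<omega> s)) *
      (ext0 (indicator (K \<inter> (if 0 \<in> J' then B 0 else UNIV))) (\<omega> (max 0 v)) *
       (\<Prod>(s, g)\<leftarrow>cylinder_list (J' - {0}) B. ext0 g (\<omega> (max 0 v + s))))))"
proof -
  have fst_list: "map fst (cylinder_list (J - {0}) A) = sorted_list_of_set (J - {0})"
    by (simp add: cylinder_list_def o_def)
  define T where "T = last (0 # sorted_list_of_set (J - {0}))"
  have "sorted_wrt (<) (0 # sorted_list_of_set (J - {0}))" using J by (auto simp: less_le)
  then have le_T: "t \<le> T" if "t \<in> insert 0 J" for t
    unfolding T_def using that J by (intro le_last_of_sorted) (auto simp del: last.simps)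
  \<comment> \<open>\<open>T\<close> is the last positive time in \<open>J\<close>, or \<open>0\<close> if there is none\<close>
  have T_in: "T = 0 \<or> T \<in> J"
    using J last_in_set[of "0 # sorted_list_of_set (J - {0})"] by (auto simp: T_def)
  show ?thesis
  proof (cases "T < v")
    case True
    then have v: "0 < v" using le_T[of 0] by simp
    have "kill_path v \<omega> t = \<omega> t" if "t \<in> J" for t
      using that J True le_T[of t] by (auto simp: kill_path_apply)
    then have "(indicator K z * indicator (cylinder J A) (kill_path v \<omega>) :: ennreal)
        = indicator (K \<inter> (if 0 \<in> J then A 0 else UNIV)) z * indicator (cylinder (J - {0}) A) \<omega>"
      using \<omega> kill_path_in[OF \<omega>(1), of v] v
      by (auto simp: indicator_def cylinder_def) (rule bexI[of _ 0], auto)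
    also have "\<dots> = indicator (K \<inter> (if 0 \<in> J then A 0 else UNIV)) z * (\<Prod>(s, g)\<leftarrow>cylinder_list (J - {0}) A. ext0 g (\<omega> s))"
      using J \<omega> by (subst indicator_cylinder) auto
    finally have 1: "indicator K z * indicator (cylinder J A) (kill_path v \<omega>)
        = indicator (K \<inter> (if 0 \<in> J then A 0 else UNIV)) z * (\<Prod>(s, g)\<leftarrow>cylinder_list (J - {0}) A. ext0 g (\<omega> s))" .
    have "(ext0 (indicator K) (\<omega> v) * indicator (cylinder J' B) (shift_path v \<omega>))
        = ext0 (indicator (K \<inter> (if 0 \<in> J' then B 0 else UNIV))) (\<omega> v) * indicator (cylinder (J' - {0}) B) (shift_path v \<omega>)"
      using \<omega> shift_path_in[OF \<omega>(1), of v] v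
      by (cases "\<omega> v")
        (auto simp: indicator_def cylinder_def ext0_def shift_path_apply, rule bexI[of _ 0], auto simp: shift_path_apply)
    also have "indicator (cylinder (J' - {0}) B) (shift_path v \<omega>)
        = (\<Prod>(s, g)\<leftarrow>cylinder_list (J' - {0}) B. ext0 g (shift_path v \<omega> s))"
      using J' shift_path_in[OF \<omega>(1), of v] v by (subst indicator_cylinder) auto
    also have "map (\<lambda>(s, g). ext0 g (shift_path v \<omega> s)) (cylinder_list (J' - {0}) B)
        = map (\<lambda>(s, g). ext0 g (\<omega> (v + s))) (cylinder_list (J' - {0}) B)"
      using J' by (intro map_cong) (auto simp: cylinder_list_def shift_path_apply subset_iff)
    finally have 2: "ext0 (indicator K) (\<omega> v) * indicator (cylinder J' B) (shift_path v \<omega>)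
        = ext0 (indicator (K \<inter> (if 0 \<in> J' then B 0 else UNIV))) (\<omega> v) *
          (\<Prod>(s, g)\<leftarrow>cylinder_list (J' - {0}) B. ext0 g (\<omega> (v + s)))" .
    have "marked K (\<omega>, v) * indicator (cylinder J A \<times> cylinder J' B) (cut_path (\<omega>, v))
        = (indicator K z * indicator (cylinder J A) (kill_path v \<omega>)) *
          (ext0 (indicator K) (\<omega> v) * indicator (cylinder J' B) (shift_path v \<omega>))"
      using v \<omega> by (simp add: marked_def cut_path_def max_absorb2 indicator_times mult_ac)
        (simp add: ext0_def mult_ac)
    then show ?thesis unfolding fst_list T_def[symmetric] 1 2 using True v
      by (simp add: max_absorb2 mult_ac)
  next
    case False
    have "marked K (\<omega>, v) * indicator (cylinder J A \<times> cylinder J' B) (cut_path (\<omega>, v)) = 0"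
    proof (cases "0 < v")
      case True
      then have "T \<in> J" using T_in False by auto
      moreover have "kill_path v \<omega> T = None" using False True by (simp add: kill_path_apply)
      ultimately have "kill_path v \<omega> \<notin> cylinder J A" by (force simp: cylinder_def)
      then show ?thesis using True by (simp add: cut_path_def max_absorb2)
    qed (simp add: marked_def)
    then show ?thesis unfolding fst_list T_def[symmetric] using False by simp
  qed
qed

text \<open>
  The conditions on the two arcs form one admissible list, to which the finite-dimensional
  distributions of \<open>Q\<^sup>z\<^sup>,\<^sup>z\<close> apply; splitting its chain at the cutting time isolates the transition
  that leads from the last observation of the first arc to the cutting point.
\<close>
lemma cut_chain:
  assumes Q: "is_Qzz P u z M" and ps: "admissible 0 ps" and qs: "admissible 0 qs" and E [measurable]: "E \<in> sets borel"
  shows "(\<integral>\<^sup>+ \<omega>. indicator {last (0 # map fst ps)<..} v *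
     ((\<Prod>(s, g)\<leftarrow>ps. ext0 g (\<omega> s)) *
      (ext0 (indicator E) (\<omega> (max 0 v)) * (\<Prod>(s, g)\<leftarrow>qs. ext0 g (\<omega> (max 0 v + s))))) \<partial>M)
   = chain_term P (\<lambda>y. indicator {last (0 # map fst ps)<..} v *
       (\<integral>\<^sup>+ w. indicator E w * chain_term P (\<lambda>x. u 0 x z) 0 w qs \<partial>P (max 0 (v - last (0 # map fst ps))) y)) 0 z ps"
    (is "?L = chain_term P ?H 0 z ps")
proof -
  let ?T = "last (0 # map fst ps)"
  have T0: "0 \<le> ?T"
    using ps le_last_of_sorted[of "0 # map fst ps" 0] by (auto simp: admissible_def)
  show ?thesis
  proof (cases "?T < v")
    case True
    then have v: "0 < v" using T0 by simp
    let ?l = "ps @ (v, indicator E) # map (map_prod ((+) v) id) qs"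
    have "admissible (v + 0) (map (map_prod ((+) v) id) qs)" using qs by (simp only: admissible_translate)
    then have adm: "admissible 0 ?l" using ps True by (simp add: admissible_append del: last.simps)
    have "?L = (\<integral>\<^sup>+ \<omega>. (\<Prod>(s, g)\<leftarrow>?l. ext0 g (\<omega> s)) \<partial>M)"
      using True v by (intro nn_integral_cong) (simp add: o_def split_beta' max_absorb2 del: last.simps)
    also have "\<dots> = chain_term P (\<lambda>x. u 0 x z) 0 z ?l" by (rule Q_chain[OF Q adm]) simp
    also have "\<dots> = chain_term P ?H 0 z ps"
      using True chain_term_translate[of P _ v 0] by (simp add: chain_term_append del: last.simps)
    finally show ?thesis .
  next
    case False
    then show ?thesis by (simp add: chain_term_0 del: last.simps)
  qed
qed

text \<open>
  The decisive computation. The cutting time enters only through the length of the transition into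
  the cutting point \<open>y\<close>, so integrating over it replaces this transition by \<open>u(\<cdot>,y) m(dy)\<close>. Afterwards the
  first arc runs from \<open>z\<close> to \<open>y\<close> and the second from \<open>y\<close> to \<open>z\<close>, both weighted by the same recipe: the
  starting point and the cutting point of the loop have become interchangeable.
\<close>
lemma pair_law_rectangle:
  assumes Q: "is_Qzz P u z M" and K [measurable]: "K \<in> sets borel"
    and J: "finite J" "J \<subseteq> {0..}" "\<And>t. A t \<in> sets borel"
    and J': "finite J'" "J' \<subseteq> {0..}" "\<And>t. B t \<in> sets borel"
  shows "emeasure (pair_law c K M) (cylinder J A \<times> cylinder J' B)
    = c * (\<integral>\<^sup>+ y. arc_weight K J A z y * arc_weight K J' B y z \<partial>m)"
proof -
  have sM: "sets M = sets path_algebra" and spM: "space M = path_space"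
    and start: "AE \<omega> in M. \<omega> 0 = Some z"
    using Q sets_eq_imp_space_eq[of M path_algebra] by (auto simp: is_Qzz_def)
  interpret M: sigma_finite_measure M by (rule sigma_finite_Q[OF Q])
  interpret m: sigma_finite_measure m by (rule sigma_finite_m)
  interpret pair_sigma_finite lborel M ..
  note [measurable_cong] = sM sets_m
  let ?ps = "cylinder_list (J - {0}) A" and ?qs = "cylinder_list (J' - {0}) B"
  let ?h = "\<lambda>x. u 0 x z"
  define T where "T = last (0 # map fst ?ps)"
  define A0 where "A0 = K \<inter> (if 0 \<in> J then A 0 else UNIV)"
  define B0 where "B0 = K \<inter> (if 0 \<in> J' then B 0 else UNIV)"
  define \<phi> where "\<phi> w = indicator B0 w * chain_term P ?h 0 w ?qs" for w
  have [measurable]: "A0 \<in> sets borel" "B0 \<in> sets borel" using J J' K by (auto simp: A0_def B0_def)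
  have ps: "admissible 0 ?ps" and qs: "admissible 0 ?qs"
    using J J' by (auto intro!: admissible_cylinder_list simp: less_le)
  have times: "0 \<le> fst p \<and> snd p \<in> borel_measurable borel" if "p \<in> set ?ps \<union> set ?qs" for p
    using that ps qs by (auto simp: admissible_def less_imp_le)
  define G where "G \<omega> v = indicator {T<..} v * ((\<Prod>(s, g)\<leftarrow>?ps. ext0 g (\<omega> s)) *
      (ext0 (indicator B0) (\<omega> (max 0 v)) * (\<Prod>(s, g)\<leftarrow>?qs. ext0 g (\<omega> (max 0 v + s)))))" for \<omega> v
  have eq: "sets (M \<Otimes>\<^sub>M lborel) = sets (path_algebra \<Otimes>\<^sub>M lborel)" using sM by (intro sets_pair_measure_cong) auto
  have G_meas: "(\<lambda>x. G (fst x) (snd x)) \<in> borel_measurable (path_algebra \<Otimes>\<^sub>M lborel)"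
  proof -
    have [measurable]: "(\<lambda>x :: (real \<Rightarrow> 'a option) \<times> real. \<Prod>p\<leftarrow>?ps. ext0 (snd p) (fst x (fst p))) \<in> borel_measurable (path_algebra \<Otimes>\<^sub>M lborel)"
      by (rule borel_measurable_prod_list_ennreal, rule measurable_coordinate_fst) (use times in auto)
    have [measurable]: "(\<lambda>x. \<Prod>p\<leftarrow>?qs. ext0 (snd p) (fst x (max 0 (snd x) + fst p))) \<in> borel_measurable (path_algebra \<Otimes>\<^sub>M lborel)"
      by (rule borel_measurable_prod_list_ennreal, rule measurable_coordinate_pair) (use times in auto)
    have [measurable]: "(\<lambda>x. ext0 (indicator B0) (fst x (max 0 (snd x)))) \<in> borel_measurable (path_algebra \<Otimes>\<^sub>M lborel)"
      using measurable_coordinate_pair[of "indicator B0" 0] by simp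
    show ?thesis unfolding G_def split_beta' by measurable
  qed
  then have G_meas': "(\<lambda>x. G (fst x) (snd x)) \<in> borel_measurable (M \<Otimes>\<^sub>M lborel)"
    by (simp add: measurable_cong_sets[OF eq refl])
  have G_swap: "(\<lambda>(v, \<omega>). G \<omega> v) \<in> borel_measurable (lborel \<Otimes>\<^sub>M M)"
    using measurable_pair_swap[OF G_meas'] by (simp add: split_beta')
  have \<phi> [measurable]: "\<phi> \<in> borel_measurable borel"
    unfolding \<phi>_def using measurable_chain_term_1[OF qs u_measurable_1] by measurable
  have rect: "cylinder J A \<times> cylinder J' B \<in> sets (path_algebra \<Otimes>\<^sub>M path_algebra)"
    using J J' by (intro pair_measureI cylinder_in_sets)
  \<comment> \<open>the transition into the cutting point, as a function of the cutting time and of the last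
     state that is observed on the first arc\<close>
  define D where "D v y = indicator {T<..} v * (\<integral>\<^sup>+ w. \<phi> w \<partial>P (max 0 (v - T)) y)" for v y
  have kernel: "(\<lambda>z. P (max 0 (fst z - T)) (snd z)) \<in> borel \<Otimes>\<^sub>M borel \<rightarrow>\<^sub>M subprob_algebra borel"
    using measurable_compose[of "\<lambda>z. (fst z - T, snd z)" "borel \<Otimes>\<^sub>M borel" "borel \<Otimes>\<^sub>M borel", OF _ measurable_P_joint]
    by simp
  have D_meas: "(\<lambda>(v, y). D v y) \<in> borel_measurable (lborel \<Otimes>\<^sub>M borel)"
  proof -
    have [measurable]: "(\<lambda>z. \<integral>\<^sup>+ w. \<phi> w \<partial>P (max 0 (fst z - T)) (snd z)) \<in> borel_measurable (borel \<Otimes>\<^sub>M borel)"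
      by (rule measurable_compose[OF kernel nn_integral_measurable_subprob_algebra]) measurable
    show ?thesis unfolding D_def split_beta' by measurable
  qed
  \<comment> \<open>here the potential density replaces the transition of random length\<close>
  have D_int: "(\<integral>\<^sup>+ v. D v y \<partial>lborel) = (\<integral>\<^sup>+ w. u 0 y w * \<phi> w \<partial>m)" for y
  proof -
    have [measurable]: "(\<lambda>v. D v y) \<in> borel_measurable borel"
      using measurable_compose[OF measurable_Pair2'[of y borel lborel] D_meas] by simp
    have "(\<integral>\<^sup>+ v. D v y \<partial>lborel) = (\<integral>\<^sup>+ v. D (T + 1 * v) y \<partial>lborel)"
      by (subst nn_integral_real_affine[of _ 1 T]) auto
    also have "\<dots> = (\<integral>\<^sup>+ v. indicator {0<..} v * (\<integral>\<^sup>+ w. \<phi> w \<partial>P (max 0 v) y) \<partial>lborel)"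
      by (intro nn_integral_cong) (simp add: D_def indicator_def)
    also have "\<dots> = (\<integral>\<^sup>+ w. u 0 y w * \<phi> w \<partial>m)" by (rule potential_operator) measurable
    finally show ?thesis .
  qed
  have "emeasure (pair_law c K M) (cylinder J A \<times> cylinder J' B)
      = (\<integral>\<^sup>+ p. indicator (cylinder J A \<times> cylinder J' B) p \<partial>pair_law c K M)"
    using rect by (simp add: pair_law_def)
  also have "\<dots> = c * (\<integral>\<^sup>+ \<omega>. (\<integral>\<^sup>+ v. marked K (\<omega>, v) *
       indicator (cylinder J A \<times> cylinder J' B) (cut_path (\<omega>, v)) \<partial>lborel) \<partial>M)"
    using rect by (intro nn_integral_pair_law[OF sM K]) auto
  also have "(\<integral>\<^sup>+ \<omega>. (\<integral>\<^sup>+ v. marked K (\<omega>, v) *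
       indicator (cylinder J A \<times> cylinder J' B) (cut_path (\<omega>, v)) \<partial>lborel) \<partial>M)
     = (\<integral>\<^sup>+ \<omega>. (\<integral>\<^sup>+ v. indicator A0 z * G \<omega> v \<partial>lborel) \<partial>M)"
  proof (rule nn_integral_cong_AE)
    show "AE \<omega> in M. (\<integral>\<^sup>+ v. marked K (\<omega>, v) * indicator (cylinder J A \<times> cylinder J' B) (cut_path (\<omega>, v)) \<partial>lborel)
        = (\<integral>\<^sup>+ v. indicator A0 z * G \<omega> v \<partial>lborel)"
      using start AE_space
    proof eventually_elim
      case (elim \<omega>)
      then show ?case unfolding G_def A0_def B0_def T_def
        by (intro nn_integral_cong pair_law_integrand[OF J(1,2) J'(1,2)]) (simp_all add: spM)
    qed
  qed
  also have "\<dots> = (\<integral>\<^sup>+ v. (\<integral>\<^sup>+ \<omega>. indicator A0 z * G \<omega> v \<partial>M) \<partial>lborel)"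
    by (rule Fubini') (use G_swap in \<open>auto simp: split_beta'\<close>)
  also have "\<dots> = (\<integral>\<^sup>+ v. indicator A0 z * (\<integral>\<^sup>+ \<omega>. G \<omega> v \<partial>M) \<partial>lborel)"
    using measurable_compose[OF measurable_Pair1' G_swap] by (intro nn_integral_cong nn_integral_cmult) simp
  also have "\<dots> = (\<integral>\<^sup>+ v. indicator A0 z * chain_term P (D v) 0 z ?ps \<partial>lborel)"
    unfolding G_def D_def \<phi>_def T_def by (simp only: cut_chain[OF Q ps qs \<open>B0 \<in> sets borel\<close>])
  also have "\<dots> = indicator A0 z * (\<integral>\<^sup>+ v. chain_term P (D v) 0 z ?ps \<partial>lborel)"
    using measurable_compose[OF measurable_Pair2' measurable_chain_term[OF ps D_meas], of z]
    by (intro nn_integral_cmult) simp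
  also have "(\<integral>\<^sup>+ v. chain_term P (D v) 0 z ?ps \<partial>lborel) = chain_term P (\<lambda>y. \<integral>\<^sup>+ v. D v y \<partial>lborel) 0 z ?ps"
    by (rule chain_term_nn_integral[symmetric, OF ps _ D_meas]) (rule lborel.sigma_finite_measure_axioms)
  also have "\<dots> = chain_term P (\<lambda>y. \<integral>\<^sup>+ w. \<phi> w * u 0 y w \<partial>m) 0 z ?ps"
    unfolding D_int by (simp add: mult.commute)
  also have "\<dots> = (\<integral>\<^sup>+ w. chain_term P (\<lambda>y. \<phi> w * u 0 y w) 0 z ?ps \<partial>m)"
  proof (rule chain_term_nn_integral[OF ps sigma_finite_m])
    have [measurable]: "(\<lambda>x. u 0 (snd x) (fst x)) \<in> borel_measurable (borel \<Otimes>\<^sub>M borel)"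
      using measurable_pair_swap[OF u_measurable[of 0]] by (simp add: split_beta')
    show "(\<lambda>(w, y). \<phi> w * u 0 y w) \<in> borel_measurable (m \<Otimes>\<^sub>M borel)"
      unfolding split_beta' by measurable
  qed
  also have "\<dots> = (\<integral>\<^sup>+ w. \<phi> w * chain_term P (\<lambda>y. u 0 y w) 0 z ?ps \<partial>m)"
    using ps by (intro nn_integral_cong chain_term_cmult) auto
  also have "indicator A0 z * \<dots> = (\<integral>\<^sup>+ w. indicator A0 z * (\<phi> w * chain_term P (\<lambda>y. u 0 y w) 0 z ?ps) \<partial>m)"
  proof (rule nn_integral_cmult[symmetric])
    have "(\<lambda>(w, x). chain_term P (\<lambda>y. u 0 y w) 0 x ?ps) \<in> borel_measurable (borel \<Otimes>\<^sub>M borel)"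
    proof (rule measurable_chain_term[OF ps])
      show "(\<lambda>(w, y). u 0 y w) \<in> borel_measurable (borel \<Otimes>\<^sub>M borel)"
        using measurable_pair_swap[OF u_measurable[of 0]] by (simp add: split_beta')
    qed
    from measurable_compose[OF measurable_Pair2'[of z] this]
    have [measurable]: "(\<lambda>w. chain_term P (\<lambda>y. u 0 y w) 0 z ?ps) \<in> borel_measurable borel" by simp
    show "(\<lambda>w. \<phi> w * chain_term P (\<lambda>y. u 0 y w) 0 z ?ps) \<in> borel_measurable m" by measurable
  qed
  also have "\<dots> = (\<integral>\<^sup>+ y. arc_weight K J A z y * arc_weight K J' B y z \<partial>m)"
    unfolding arc_weight_def \<phi>_def A0_def[symmetric] B0_def[symmetric]
    by (intro nn_integral_cong) (simp add: mult_ac)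
  finally show ?thesis .
qed

end


section \<open>Exchangeability of the two arcs\<close>

definition rectangles :: "((real \<Rightarrow> 'a::topological_space option) \<times> (real \<Rightarrow> 'a option)) set set" where
  "rectangles = {a \<times> b | a b. a \<in> cylinders \<and> b \<in> cylinders}"

lemma Int_stable_rectangles: "Int_stable rectangles"
proof (rule Int_stableI)
  fix X Y :: "((real \<Rightarrow> 'a option) \<times> (real \<Rightarrow> 'a option)) set"
  assume "X \<in> rectangles" "Y \<in> rectangles"
  then obtain a b a' b' where *: "X = a \<times> b" "Y = a' \<times> b'" "a \<in> cylinders" "b \<in> cylinders" "a' \<in> cylinders" "b' \<in> cylinders"
    by (auto simp: rectangles_def)
  then have "X \<inter> Y = (a \<inter> a') \<times> (b \<inter> b')" by auto
  moreover have "a \<inter> a' \<in> cylinders" "b \<inter> b' \<in> cylinders"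
    using * Int_stable_cylinders by (auto simp: Int_stable_def)
  ultimately show "X \<inter> Y \<in> rectangles" by (auto simp: rectangles_def)
qed

lemma rectangles_subset: "rectangles \<subseteq> Pow (path_space \<times> path_space)"
  using cylinders_subset by (fastforce simp: rectangles_def)

lemma sets_pair_rectangles:
  "sets (path_algebra \<Otimes>\<^sub>M path_algebra) =
    sigma_sets (path_space \<times> path_space) (rectangles :: ((real \<Rightarrow> 'a::topological_space option) \<times> (real \<Rightarrow> 'a option)) set set)"
proof -
  let ?S = "sigma path_space cylinders :: (real \<Rightarrow> 'a option) measure"
  have S: "sets (path_algebra :: (real \<Rightarrow> 'a option) measure) = sets ?S"
    by (simp add: sets_path_algebra_cylinders cylinders_subset)
  have "sets (path_algebra \<Otimes>\<^sub>M path_algebra) = sets (?S \<Otimes>\<^sub>M ?S)"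
    by (intro sets_pair_measure_cong S)
  also have "?S \<Otimes>\<^sub>M ?S = sigma (path_space \<times> path_space) rectangles"
    unfolding rectangles_def using path_space_in_cylinders cylinders_subset
    by (intro sigma_prod) (auto intro!: exI[of _ "{path_space}"])
  also have "sets \<dots> = sigma_sets (path_space \<times> path_space) rectangles"
    by (simp add: rectangles_subset)
  finally show ?thesis .
qed

context loop_setting
begin

text \<open>
  The computation for a rectangle and for its mirror image, with the arc weights kept abstract.
\<close>
lemma pair_law_rectangle_obtain:
  assumes "a \<in> cylinders" "b \<in> cylinders" "K \<in> sets borel"
  obtains w w' where "(\<lambda>(x, y). w x y) \<in> borel_measurable (borel \<Otimes>\<^sub>M borel)"
    "(\<lambda>(x, y). w' x y) \<in> borel_measurable (borel \<Otimes>\<^sub>M borel)"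
    "\<And>c z M. is_Qzz P u z M \<Longrightarrow> emeasure (pair_law c K M) (a \<times> b) = c * (\<integral>\<^sup>+ y. w z y * w' y z \<partial>m)"
    "\<And>c z M. is_Qzz P u z M \<Longrightarrow> emeasure (pair_law c K M) (b \<times> a) = c * (\<integral>\<^sup>+ y. w' z y * w y z \<partial>m)"
proof -
  from assms obtain J A J' B where
    a: "a = cylinder J A" "finite J" "J \<subseteq> {0..}" "\<And>t. A t \<in> sets borel" and
    b: "b = cylinder J' B" "finite J'" "J' \<subseteq> {0..}" "\<And>t. B t \<in> sets borel"
    by (auto simp: cylinders_def)
  show ?thesis
    by (rule that[of "arc_weight K J A" "arc_weight K J' B"])
       (use a b assms(3) in \<open>auto intro!: arc_weight_measurable pair_law_rectangle\<close>)
qed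

lemma arc_weight_product_measurable:
  fixes w w' :: "'a \<Rightarrow> 'a \<Rightarrow> ennreal"
  assumes "(\<lambda>(x, y). w x y) \<in> borel_measurable (borel \<Otimes>\<^sub>M borel)"
    and "(\<lambda>(x, y). w' x y) \<in> borel_measurable (borel \<Otimes>\<^sub>M borel)"
  shows "(\<lambda>(x, y). w x y * w' y x) \<in> borel_measurable (m \<Otimes>\<^sub>M m)"
proof -
  have eq: "sets (m \<Otimes>\<^sub>M m) = sets (borel \<Otimes>\<^sub>M borel)" by (intro sets_pair_measure_cong sets_m)
  have [measurable]: "(\<lambda>z. w (fst z) (snd z)) \<in> borel_measurable (borel \<Otimes>\<^sub>M borel)"
    "(\<lambda>z. w' (snd z) (fst z)) \<in> borel_measurable (borel \<Otimes>\<^sub>M borel)"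
    using assms(1) measurable_pair_swap[OF assms(2)] by (simp_all add: split_beta')
  show ?thesis unfolding measurable_cong_sets[OF eq refl] split_beta' by measurable
qed

context
  fixes Q :: "'a \<Rightarrow> (real \<Rightarrow> 'a option) measure" and K :: "'a set"
  assumes Q: "\<And>z. is_Qzz P u z (Q z)" and K: "compact K"
begin

definition mass_bound :: ennreal where
  "mass_bound = (SUP x. \<integral>\<^sup>+ y\<in>K. (u 0 x y + u 0 y x)\<^sup>2 \<partial>m)"

definition mass_scale :: ennreal where
  "mass_scale = inverse (1 + mass_bound)"

lemma K_borel: "K \<in> sets borel"
  using K by (rule borel_compact)

lemma mass_scale: "mass_scale \<noteq> 0" "mass_scale \<noteq> \<top>" "mass_scale * mass_bound \<le> 1"
proof -
  have fin: "mass_bound < \<infinity>" unfolding mass_bound_def by (rule u_square_integrable[OF K])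
  then show "mass_scale \<noteq> 0" "mass_scale \<noteq> \<top>" by (auto simp: mass_scale_def)
  \<comment> \<open>the summand \<open>1\<close> in the constant prevents division by zero\<close>
  have "mass_scale * mass_bound \<le> mass_scale * (1 + mass_bound)" by (intro mult_left_mono) auto
  also have "\<dots> = (1 + mass_bound) / (1 + mass_bound)"
    by (simp add: mass_scale_def divide_ennreal_def mult.commute)
  also have "\<dots> = 1" using fin by (intro ennreal_divide_self) auto
  finally show "mass_scale * mass_bound \<le> 1" .
qed

lemma sets_Q: "sets (Q z) = sets path_algebra"
  using Q by (simp add: is_Qzz_def)

text \<open>
  Two arcs without conditions have weight \<open>u(z,y) u(y,z) \<le> (u(z,y) + u(y,z))\<^sup>2\<close>, and the integral of
  this square over \<open>K\<close> is bounded uniformly in \<open>z\<close>. The bound makes the laws of the arcs a kernel of finite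
  measures although \<open>Q\<^sup>z\<^sup>,\<^sup>z\<close> may have infinite mass.
\<close>
lemma pair_law_mass: "emeasure (pair_law mass_scale K (Q z)) (path_space \<times> path_space) \<le> indicator K z"
proof -
  have "emeasure (pair_law mass_scale K (Q z)) (path_space \<times> path_space)
      = mass_scale * (\<integral>\<^sup>+ y. arc_weight K {} (\<lambda>_. {}) z y * arc_weight K {} (\<lambda>_. {}) y z \<partial>m)"
    using pair_law_rectangle[OF Q K_borel, of "{}" "\<lambda>_. {}" "{}" "\<lambda>_. {}"] by (simp add: cylinder_def)
  also have "(\<integral>\<^sup>+ y. arc_weight K {} (\<lambda>_. {}) z y * arc_weight K {} (\<lambda>_. {}) y z \<partial>m)
      = (\<integral>\<^sup>+ y. indicator K z * ((u 0 z y * u 0 y z) * indicator K y) \<partial>m)"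
    by (intro nn_integral_cong) (simp add: arc_weight_def cylinder_list_def mult_ac)
  also have "\<dots> \<le> (\<integral>\<^sup>+ y. indicator K z * ((u 0 z y + u 0 y z)\<^sup>2 * indicator K y) \<partial>m)"
  proof (intro nn_integral_mono mult_left_mono mult_right_mono)
    show "u 0 z y * u 0 y z \<le> (u 0 z y + u 0 y z)\<^sup>2" for y
      unfolding power2_eq_square by (intro mult_mono) auto
  qed auto
  also have "\<dots> \<le> indicator K z * mass_bound"
    unfolding mass_bound_def by (cases "z \<in> K") (auto intro: SUP_upper)
  finally have "emeasure (pair_law mass_scale K (Q z)) (path_space \<times> path_space) \<le> mass_scale * (indicator K z * mass_bound)"
    by (simp add: mult_left_mono)
  also have "\<dots> = indicator K z * (mass_scale * mass_bound)" by (simp add: mult_ac)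
  also have "\<dots> \<le> indicator K z * 1" by (intro mult_left_mono mass_scale) auto
  finally show ?thesis by simp
qed

lemma pair_law_kernel: "(\<lambda>z. pair_law mass_scale K (Q z)) \<in> m \<rightarrow>\<^sub>M subprob_algebra (path_algebra \<Otimes>\<^sub>M path_algebra)"
proof (rule measurable_subprob_algebra_generated[OF sets_pair_rectangles Int_stable_rectangles rectangles_subset])
  fix z
  show "sets (pair_law mass_scale K (Q z)) = sets (path_algebra \<Otimes>\<^sub>M path_algebra)" by (simp add: pair_law_def)
  have sp: "space (pair_law mass_scale K (Q z)) = path_space \<times> path_space"
    by (simp add: pair_law_def space_pair_measure)
  show "subprob_space (pair_law mass_scale K (Q z))"
  proof
    show "emeasure (pair_law mass_scale K (Q z)) (space (pair_law mass_scale K (Q z))) \<le> 1"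
      unfolding sp using pair_law_mass[of z] by (rule order_trans) (simp add: indicator_def)
    have "path_space \<noteq> ({} :: (real \<Rightarrow> 'a option) set)"
      using prob_space.not_empty[OF Px_prob, of undefined] sets_eq_imp_space_eq[OF sets_Px, of undefined] by auto
    then show "space (pair_law mass_scale K (Q z)) \<noteq> {}" unfolding sp by auto
  qed
next
  have *: "(\<lambda>z. emeasure (pair_law mass_scale K (Q z)) X) \<in> borel_measurable m" if X: "X \<in> rectangles" for X
  proof -
    from X obtain a b where ab: "X = a \<times> b" "a \<in> cylinders" "b \<in> cylinders" by (auto simp: rectangles_def)
    obtain w w' where w: "(\<lambda>(x, y). w x y) \<in> borel_measurable (borel \<Otimes>\<^sub>M borel)"
      "(\<lambda>(x, y). w' x y) \<in> borel_measurable (borel \<Otimes>\<^sub>M borel)"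
      "\<And>c z M. is_Qzz P u z M \<Longrightarrow> emeasure (pair_law c K M) (a \<times> b) = c * (\<integral>\<^sup>+ y. w z y * w' y z \<partial>m)"
      "\<And>c z M. is_Qzz P u z M \<Longrightarrow> emeasure (pair_law c K M) (b \<times> a) = c * (\<integral>\<^sup>+ y. w' z y * w y z \<partial>m)"
      by (rule pair_law_rectangle_obtain[OF ab(2,3) K_borel]) (rule that)
    note [measurable] = arc_weight_product_measurable[OF w(1,2)]
    have "(\<lambda>z. \<integral>\<^sup>+ y. w z y * w' y z \<partial>m) \<in> borel_measurable m"
      by (intro sigma_finite_measure.borel_measurable_nn_integral[OF sigma_finite_m]) measurable
    then show ?thesis unfolding ab(1) w(3)[OF Q] by measurable
  qed
  show "(\<lambda>z. emeasure (pair_law mass_scale K (Q z)) X) \<in> borel_measurable m" if "X \<in> rectangles" for X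
    using * that .
  show "(\<lambda>z. emeasure (pair_law mass_scale K (Q z)) (path_space \<times> path_space)) \<in> borel_measurable m"
    using path_space_in_cylinders by (intro *) (auto simp: rectangles_def)
qed

text \<open>
  Monotone convergence in \<open>z\<close> needs this measurability, which has to be derived from the
  finite-dimensional distributions of the measures \<open>Q\<^sup>z\<^sup>,\<^sup>z\<close>; it is read off from the kernel by removing
  the constant.
\<close>
lemma measurable_marked_integral:
  assumes f: "f \<in> borel_measurable (path_algebra \<Otimes>\<^sub>M path_algebra)"
  shows "(\<lambda>z. \<integral>\<^sup>+ \<omega>. (\<integral>\<^sup>+ v. marked K (\<omega>, v) * f (cut_path (\<omega>, v)) \<partial>lborel) \<partial>Q z) \<in> borel_measurable m"
proof -
  have "(\<lambda>z. inverse mass_scale * (\<integral>\<^sup>+ p. f p \<partial>pair_law mass_scale K (Q z))) \<in> borel_measurable m"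
  proof -
    note [measurable] = measurable_compose[OF pair_law_kernel nn_integral_measurable_subprob_algebra[OF f]]
    show ?thesis by measurable
  qed
  moreover have "inverse mass_scale * (mass_scale * x) = x" for x
  proof -
    have "inverse mass_scale * mass_scale = mass_scale / mass_scale" by (simp add: divide_ennreal_def mult.commute)
    also have "\<dots> = 1" using mass_scale by (intro ennreal_divide_self) (auto simp: less_top)
    finally show ?thesis by (simp flip: mult.assoc)
  qed
  ultimately show ?thesis by (simp add: nn_integral_pair_law[OF sets_Q K_borel f])
qed

text \<open>
  Integrating the laws of the arcs over \<open>m(dz)\<close> gives a finite measure on pairs of paths. On a rectangle
  of cylinder sets it is the integral of \<open>w(z,y) w'(y,z)\<close> over \<open>m(dz) m(dy)\<close>; exchanging the two arcs
  amounts to renaming \<open>z\<close> and \<open>y\<close>, which Tonelli's theorem allows. The rectangles are closed under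
  intersection, so this finite measure is symmetric.
\<close>
lemma pair_law_swap:
  assumes f: "f \<in> borel_measurable (path_algebra \<Otimes>\<^sub>M path_algebra)"
  shows "(\<integral>\<^sup>+ z. (\<integral>\<^sup>+ \<omega>. (\<integral>\<^sup>+ v. marked K (\<omega>, v) * f (cut_path (\<omega>, v)) \<partial>lborel) \<partial>Q z) \<partial>m)
       = (\<integral>\<^sup>+ z. (\<integral>\<^sup>+ \<omega>. (\<integral>\<^sup>+ v. marked K (\<omega>, v) * f (prod.swap (cut_path (\<omega>, v))) \<partial>lborel) \<partial>Q z) \<partial>m)"
proof -
  interpret m: sigma_finite_measure m by (rule sigma_finite_m)
  interpret mm: pair_sigma_finite m m ..
  let ?PP = "path_algebra \<Otimes>\<^sub>M path_algebra :: ((real \<Rightarrow> 'a option) \<times> (real \<Rightarrow> 'a option)) measure"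
  let ?L = "\<lambda>z. pair_law mass_scale K (Q z)"
  let ?N = "m \<bind> ?L"
  have swap: "prod.swap \<in> ?PP \<rightarrow>\<^sub>M ?PP"
  proof -
    have eq: "(prod.swap :: (real \<Rightarrow> 'a option) \<times> (real \<Rightarrow> 'a option) \<Rightarrow> _) = (\<lambda>(x, y). (y, x))" by auto
    show ?thesis unfolding eq by (rule measurable_pair_swap')
  qed
  have ne: "space m \<noteq> {}" using sets_eq_imp_space_eq[OF sets_m] by simp
  have sN: "sets ?N = sets ?PP"
    by (rule sets_bind[OF _ ne]) (simp add: pair_law_def)
  have em: "emeasure ?N X = (\<integral>\<^sup>+ z. emeasure (?L z) X \<partial>m)" if "X \<in> sets ?PP" for X
    by (rule emeasure_bind[OF ne pair_law_kernel that])
  have spPP: "space ?PP = path_space \<times> path_space" by (simp add: space_pair_measure)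
  have rect_sets: "X \<in> sets ?PP" if "X \<in> rectangles" for X
    unfolding sets_pair_rectangles using that by auto
  have fin: "emeasure ?N (path_space \<times> path_space) \<noteq> \<infinity>"
  proof -
    have "emeasure ?N (path_space \<times> path_space) = (\<integral>\<^sup>+ z. emeasure (?L z) (path_space \<times> path_space) \<partial>m)"
      unfolding spPP[symmetric] by (rule em) simp
    also have "\<dots> \<le> (\<integral>\<^sup>+ z. indicator K z \<partial>m)" by (intro nn_integral_mono pair_law_mass)
    also have "\<dots> = emeasure m K" using K_borel sets_m by simp
    also have "\<dots> < \<infinity>" by (rule m_compact[OF K])
    finally show ?thesis by simp
  qed
  have "?N = distr ?N ?PP prod.swap"
  proof (rule measure_eqI_generator_eq[OF Int_stable_rectangles rectangles_subset])
    fix X :: "((real \<Rightarrow> 'a option) \<times> (real \<Rightarrow> 'a option)) set" assume X: "X \<in> rectangles"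
    then obtain a b where ab: "X = a \<times> b" "a \<in> cylinders" "b \<in> cylinders" by (auto simp: rectangles_def)
    obtain w w' where w: "(\<lambda>(x, y). w x y) \<in> borel_measurable (borel \<Otimes>\<^sub>M borel)"
      "(\<lambda>(x, y). w' x y) \<in> borel_measurable (borel \<Otimes>\<^sub>M borel)"
      "\<And>c z M. is_Qzz P u z M \<Longrightarrow> emeasure (pair_law c K M) (a \<times> b) = c * (\<integral>\<^sup>+ y. w z y * w' y z \<partial>m)"
      "\<And>c z M. is_Qzz P u z M \<Longrightarrow> emeasure (pair_law c K M) (b \<times> a) = c * (\<integral>\<^sup>+ y. w' z y * w y z \<partial>m)"
      by (rule pair_law_rectangle_obtain[OF ab(2,3) K_borel]) (rule that)
    have ba: "b \<times> a \<in> rectangles" using ab by (auto simp: rectangles_def)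
    note meas = arc_weight_product_measurable[OF w(1,2)] arc_weight_product_measurable[OF w(2,1)]
    have "emeasure (distr ?N ?PP prod.swap) X = emeasure ?N (prod.swap -` X \<inter> space ?N)"
      using swap rect_sets[OF X] by (intro emeasure_distr) (simp_all add: measurable_cong_sets[OF sN refl])
    also have "prod.swap -` X \<inter> space ?N = b \<times> a"
      using ab cylinders_subset sets_eq_imp_space_eq[OF sN] by (auto simp: spPP)
    also have "emeasure ?N (b \<times> a) = (\<integral>\<^sup>+ z. mass_scale * (\<integral>\<^sup>+ y. w' z y * w y z \<partial>m) \<partial>m)"
      unfolding em[OF rect_sets[OF ba]] w(4)[OF Q] ..
    also have "\<dots> = mass_scale * (\<integral>\<^sup>+ z. (\<integral>\<^sup>+ y. w' z y * w y z \<partial>m) \<partial>m)"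
      using m.borel_measurable_nn_integral[OF meas(2)] by (rule nn_integral_cmult)
    also have "(\<integral>\<^sup>+ z. (\<integral>\<^sup>+ y. w' z y * w y z \<partial>m) \<partial>m) = (\<integral>\<^sup>+ y. (\<integral>\<^sup>+ z. w' z y * w y z \<partial>m) \<partial>m)"
      by (rule mm.Fubini'[symmetric, OF meas(2)])
    also have "\<dots> = (\<integral>\<^sup>+ z. (\<integral>\<^sup>+ y. w z y * w' y z \<partial>m) \<partial>m)" by (simp add: mult.commute)
    also have "mass_scale * \<dots> = (\<integral>\<^sup>+ z. mass_scale * (\<integral>\<^sup>+ y. w z y * w' y z \<partial>m) \<partial>m)"
      using m.borel_measurable_nn_integral[OF meas(1)] by (rule nn_integral_cmult[symmetric])
    also have "\<dots> = emeasure ?N X"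
      unfolding em[OF rect_sets[OF X]] unfolding ab(1) w(3)[OF Q] ..
    finally show "emeasure ?N X = emeasure (distr ?N ?PP prod.swap) X" ..
  next
    show "range (\<lambda>_::nat. path_space \<times> path_space) \<subseteq> rectangles"
      using path_space_in_cylinders by (auto simp: rectangles_def)
    show "emeasure ?N (path_space \<times> path_space) \<noteq> \<infinity>" for i :: nat by (rule fin)
  qed (auto simp: sN sets_pair_rectangles)
  then have "(\<integral>\<^sup>+ p. f p \<partial>?N) = (\<integral>\<^sup>+ p. f p \<partial>distr ?N ?PP prod.swap)" by simp
  also have "\<dots> = (\<integral>\<^sup>+ p. f (prod.swap p) \<partial>?N)"
    using swap f by (intro nn_integral_distr) (simp_all add: measurable_cong_sets[OF sN refl])
  finally have eq: "(\<integral>\<^sup>+ p. f p \<partial>?N) = (\<integral>\<^sup>+ p. f (prod.swap p) \<partial>?N)" .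
  have N_int: "(\<integral>\<^sup>+ p. g p \<partial>?N) =
      mass_scale * (\<integral>\<^sup>+ z. (\<integral>\<^sup>+ \<omega>. (\<integral>\<^sup>+ v. marked K (\<omega>, v) * g (cut_path (\<omega>, v)) \<partial>lborel) \<partial>Q z) \<partial>m)"
    if g: "g \<in> borel_measurable ?PP" for g
  proof -
    have "(\<integral>\<^sup>+ p. g p \<partial>?N) = (\<integral>\<^sup>+ z. (\<integral>\<^sup>+ p. g p \<partial>?L z) \<partial>m)"
      by (rule nn_integral_bind[OF g pair_law_kernel])
    then show ?thesis
      unfolding nn_integral_pair_law[OF sets_Q K_borel g]
      by (simp add: nn_integral_cmult measurable_marked_integral[OF g])
  qed
  from eq show ?thesis
    unfolding N_int[OF f] N_int[OF measurable_compose[OF swap f]]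
    using mass_scale by (simp add: ennreal_mult_cancel_left)
qed

end

end


section \<open>Averaging over rotations\<close>

definition open_loop_interval :: "(real \<Rightarrow> 'a option) \<Rightarrow> real set" where
  "open_loop_interval \<omega> = {v. 0 < v \<and> ennreal v < lifetime \<omega>}"

lemma SUP_marked:
  assumes \<omega>: "\<omega> \<in> path_space" and K: "incseq K" "(\<Union>n. K n) = UNIV"
  shows "(SUP n. marked (K n) (\<omega>, v)) = indicator (open_loop_interval \<omega>) v"
proof (cases "v \<in> open_loop_interval \<omega>")
  case True
  then have v: "0 < v" "ennreal v < lifetime \<omega>" by (auto simp: open_loop_interval_def)
  then have "\<omega> v \<noteq> None" "\<omega> 0 \<noteq> None" using path_None_iff[OF \<omega>, of v] path_None_iff[OF \<omega>, of 0] by auto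
  then obtain x y where xy: "\<omega> 0 = Some x" "\<omega> v = Some y" by auto
  obtain i j where "x \<in> K i" "y \<in> K j" using K(2) by blast
  then have "x \<in> K (max i j)" "y \<in> K (max i j)"
    using incseqD[OF K(1), of i "max i j"] incseqD[OF K(1), of j "max i j"] by auto
  then have "marked (K (max i j)) (\<omega>, v) = 1"
    using v xy by (simp add: marked_def ext0_def max_absorb2)
  moreover have "marked (K n) (\<omega>, v) \<le> 1" for n
    using v xy by (auto simp: marked_def ext0_def indicator_def max_absorb2)
  ultimately have "(SUP n. marked (K n) (\<omega>, v)) = 1"
    by (intro antisym SUP_least) (auto intro: SUP_upper2[of "max i j"])
  then show ?thesis using True by simp
next
  case False
  have "marked (K n) (\<omega>, v) = 0" for n
  proof (cases "0 < v")
    case True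
    then have "\<omega> v = None" using False path_None_iff[OF \<omega>, of v] by (auto simp: open_loop_interval_def)
    then show ?thesis using True by (simp add: marked_def ext0_def max_absorb2)
  qed (simp add: marked_def)
  then show ?thesis using False by simp
qed

lemma incseq_marked: "incseq K \<Longrightarrow> incseq (\<lambda>n. marked (K n) x)"
proof (rule incseq_SucI)
  fix n assume "incseq K"
  then have "K n \<subseteq> K (Suc n)" by (simp add: incseq_SucD)
  then have "ext0 (indicator (K n)) y \<le> (ext0 (indicator (K (Suc n))) y :: ennreal)" for y
    by (cases y) (auto simp: ext0_def indicator_def)
  then show "marked (K n) x \<le> marked (K (Suc n)) x"
    unfolding marked_def split_beta' by (intro mult_mono) auto
qed

text \<open>
  After reducing the translation to \<open>0 \<le> r < l\<close>, the part \<open>{l..<r + l}\<close> of the translated interval is moved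
  back by one period, where it fills the gap \<open>{0..<r}\<close> up to the endpoints.
\<close>
lemma nn_integral_periodic_translate:
  fixes g :: "real \<Rightarrow> ennreal"
  assumes g [measurable]: "g \<in> borel_measurable borel" and l: "0 < l"
    and periodic: "\<And>v. g (v rmod l) = g v"
  shows "(\<integral>\<^sup>+ v. indicator {0<..<l} v * g (w + v) \<partial>lborel) = (\<integral>\<^sup>+ v. indicator {0<..<l} v * g v \<partial>lborel)"
proof -
  define r where "r = w rmod l"
  have r: "0 \<le> r" "r < l" using l by (auto simp: r_def rmod_less rmod_nonneg)
  have g_r: "g (w + v) = g (r + v)" for v
  proof -
    have "(w + v) rmod l = (r + v) rmod l" unfolding r_def by (metis rmod_add rmod_rmod)
    then show ?thesis using periodic by metis
  qed
  have g_l: "g (l + v) = g v" for v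
  proof -
    have "(l + v) rmod l = v rmod l" by (metis rmod_add rmod_self add_0 rmod_rmod)
    then show ?thesis using periodic by metis
  qed
  have "(\<integral>\<^sup>+ v. indicator {0<..<l} v * g (w + v) \<partial>lborel) = (\<integral>\<^sup>+ v. indicator {r<..<r + l} (r + 1 * v) * g (r + 1 * v) \<partial>lborel)"
    by (intro nn_integral_cong) (auto simp: g_r indicator_def)
  also have "\<dots> = (\<integral>\<^sup>+ v. indicator {r<..<r + l} v * g v \<partial>lborel)"
    by (subst nn_integral_real_affine[of "\<lambda>v. indicator {r<..<r + l} v * g v" 1 r]) auto
  also have "\<dots> = (\<integral>\<^sup>+ v. indicator {r<..<l} v * g v + indicator {l..<r + l} v * g v \<partial>lborel)"
    using r by (intro nn_integral_cong) (auto simp: indicator_def)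
  also have "\<dots> = (\<integral>\<^sup>+ v. indicator {r<..<l} v * g v \<partial>lborel) + (\<integral>\<^sup>+ v. indicator {l..<r + l} v * g v \<partial>lborel)"
    by (rule nn_integral_add) measurable
  also have "(\<integral>\<^sup>+ v. indicator {l..<r + l} v * g v \<partial>lborel) = (\<integral>\<^sup>+ v. indicator {l..<r + l} (l + 1 * v) * g (l + 1 * v) \<partial>lborel)"
    by (subst nn_integral_real_affine[of "\<lambda>v. indicator {l..<r + l} v * g v" 1 l]) auto
  also have "\<dots> = (\<integral>\<^sup>+ v. indicator {0..<r} v * g v \<partial>lborel)"
    by (intro nn_integral_cong) (auto simp: g_l indicator_def)
  also have "(\<integral>\<^sup>+ v. indicator {r<..<l} v * g v \<partial>lborel) + \<dots> = (\<integral>\<^sup>+ v. indicator {r<..<l} v * g v + indicator {0..<r} v * g v \<partial>lborel)"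
    by (rule nn_integral_add[symmetric]) measurable
  also have "\<dots> = (\<integral>\<^sup>+ v. indicator {0<..<l} v * g v \<partial>lborel)"
  proof (rule nn_integral_cong_AE)
    have "AE v in lborel. v \<noteq> 0" "AE v in lborel. v \<noteq> r" by (rule AE_lborel_singleton)+
    then show "AE v in lborel. indicator {r<..<l} v * g v + indicator {0..<r} v * g v = indicator {0<..<l} v * g v"
      by eventually_elim (use r in \<open>auto simp: indicator_def\<close>)
  qed
  finally show ?thesis .
qed

context loop_setting
begin

context
  fixes Q :: "'a \<Rightarrow> (real \<Rightarrow> 'a option) measure"
  assumes Q: "\<And>z. is_Qzz P u z (Q z)"
begin

text \<open>
  As \<open>K\<close> exhausts the state space, the constraint on starting and cutting point becomes the bare
  requirement that the loop be cut during its lifetime.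
\<close>
lemma cut_integral_SUP:
  assumes f: "f \<in> borel_measurable (path_algebra \<Otimes>\<^sub>M path_algebra)"
    and K: "\<And>n. compact (K n)" "incseq K" "(\<Union>n. K n) = UNIV"
  shows "(\<integral>\<^sup>+ z. (\<integral>\<^sup>+ \<omega>. (\<integral>\<^sup>+ v. indicator (open_loop_interval \<omega>) v * f (cut_path (\<omega>, v)) \<partial>lborel) \<partial>Q z) \<partial>m)
    = (SUP n. \<integral>\<^sup>+ z. (\<integral>\<^sup>+ \<omega>. (\<integral>\<^sup>+ v. marked (K n) (\<omega>, v) * f (cut_path (\<omega>, v)) \<partial>lborel) \<partial>Q z) \<partial>m)"
proof -
  have sQ: "sets (Q z) = sets path_algebra" and spQ: "space (Q z) = path_space" for z
    using Q[of z] sets_eq_imp_space_eq[of "Q z" path_algebra] by (auto simp: is_Qzz_def)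
  have Kb: "K n \<in> sets borel" for n using K(1) by (rule borel_compact)
  have joint: "(\<lambda>x. marked (K n) x * f (cut_path x)) \<in> borel_measurable (path_algebra \<Otimes>\<^sub>M lborel)" for n
  proof -
    note [measurable] = measurable_compose[OF measurable_cut_path f] measurable_marked[OF Kb]
    show ?thesis by measurable
  qed
  have mono: "incseq (\<lambda>n. marked (K n) x * f (cut_path x))" for x
    using incseq_marked[OF K(2), of x] by (auto simp: incseq_def intro: mult_right_mono)
  have v_int: "(\<integral>\<^sup>+ v. indicator (open_loop_interval \<omega>) v * f (cut_path (\<omega>, v)) \<partial>lborel)
      = (SUP n. \<integral>\<^sup>+ v. marked (K n) (\<omega>, v) * f (cut_path (\<omega>, v)) \<partial>lborel)" if \<omega>: "\<omega> \<in> path_space" for \<omega>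
  proof -
    have "(\<integral>\<^sup>+ v. indicator (open_loop_interval \<omega>) v * f (cut_path (\<omega>, v)) \<partial>lborel)
        = (\<integral>\<^sup>+ v. (SUP n. marked (K n) (\<omega>, v) * f (cut_path (\<omega>, v))) \<partial>lborel)"
      by (simp add: SUP_marked[OF \<omega> K(2,3), symmetric] SUP_mult_right_ennreal)
    also have "\<dots> = (SUP n. \<integral>\<^sup>+ v. marked (K n) (\<omega>, v) * f (cut_path (\<omega>, v)) \<partial>lborel)"
      using mono measurable_compose[OF measurable_Pair1' joint] \<omega>
      by (intro nn_integral_monotone_convergence_SUP) (auto simp: incseq_def le_fun_def)
    finally show ?thesis .
  qed
  have \<omega>_meas: "(\<lambda>\<omega>. \<integral>\<^sup>+ v. marked (K n) (\<omega>, v) * f (cut_path (\<omega>, v)) \<partial>lborel) \<in> borel_measurable (Q z)" for n z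
    using lborel.borel_measurable_nn_integral_fst[OF joint, of n] by (simp add: measurable_cong_sets[OF sQ refl])
  have \<omega>_int: "(\<integral>\<^sup>+ \<omega>. (\<integral>\<^sup>+ v. indicator (open_loop_interval \<omega>) v * f (cut_path (\<omega>, v)) \<partial>lborel) \<partial>Q z)
      = (SUP n. \<integral>\<^sup>+ \<omega>. (\<integral>\<^sup>+ v. marked (K n) (\<omega>, v) * f (cut_path (\<omega>, v)) \<partial>lborel) \<partial>Q z)" for z
  proof -
    have "(\<integral>\<^sup>+ \<omega>. (\<integral>\<^sup>+ v. indicator (open_loop_interval \<omega>) v * f (cut_path (\<omega>, v)) \<partial>lborel) \<partial>Q z)
       = (\<integral>\<^sup>+ \<omega>. (SUP n. \<integral>\<^sup>+ v. marked (K n) (\<omega>, v) * f (cut_path (\<omega>, v)) \<partial>lborel) \<partial>Q z)"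
      by (intro nn_integral_cong v_int) (simp add: spQ)
    also have "\<dots> = (SUP n. \<integral>\<^sup>+ \<omega>. (\<integral>\<^sup>+ v. marked (K n) (\<omega>, v) * f (cut_path (\<omega>, v)) \<partial>lborel) \<partial>Q z)"
      using mono \<omega>_meas
      by (intro nn_integral_monotone_convergence_SUP) (auto simp: incseq_def le_fun_def intro!: nn_integral_mono)
    finally show ?thesis .
  qed
  show ?thesis unfolding \<omega>_int
    using mono measurable_marked_integral[OF Q K(1) f]
    by (intro nn_integral_monotone_convergence_SUP) (auto simp: incseq_def le_fun_def intro!: nn_integral_mono)
qed

lemma cut_integral_swap:
  assumes f: "f \<in> borel_measurable (path_algebra \<Otimes>\<^sub>M path_algebra)"
  shows "(\<integral>\<^sup>+ z. (\<integral>\<^sup>+ \<omega>. (\<integral>\<^sup>+ v. indicator (open_loop_interval \<omega>) v * f (cut_path (\<omega>, v)) \<partial>lborel) \<partial>Q z) \<partial>m)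
    = (\<integral>\<^sup>+ z. (\<integral>\<^sup>+ \<omega>. (\<integral>\<^sup>+ v. indicator (open_loop_interval \<omega>) v * f (prod.swap (cut_path (\<omega>, v))) \<partial>lborel) \<partial>Q z) \<partial>m)"
proof -
  obtain K :: "nat \<Rightarrow> 'a set" where K: "\<And>n. compact (K n)" "incseq K" "(\<Union>n. K n) = UNIV"
    using compact_exhaustion[OF state_space] by metis
  have "(\<lambda>p. f (snd p, fst p)) \<in> borel_measurable (path_algebra \<Otimes>\<^sub>M path_algebra)"
    by (rule measurable_compose[OF _ f]) measurable
  then have f': "(\<lambda>p. f (prod.swap p)) \<in> borel_measurable (path_algebra \<Otimes>\<^sub>M path_algebra)"
    by (simp add: prod.swap_def)
  show ?thesis
    unfolding cut_integral_SUP[OF f K] cut_integral_SUP[OF f' K] pair_law_swap[OF Q K(1) f] ..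
qed

text \<open>
  Gluing the two arcs in their order gives back the loop, and gluing them in the opposite order gives
  the rotated loop, so this is the symmetry of the pair of arcs seen after gluing. A path of infinite
  lifetime is not reproduced by gluing its arcs in the opposite order, which is why \<open>H\<close> must vanish there.
\<close>
lemma rotation_average:
  assumes H: "H \<in> borel_measurable path_algebra" and H0: "\<And>\<omega>. lifetime \<omega> = \<infinity> \<Longrightarrow> H \<omega> = 0"
  shows "(\<integral>\<^sup>+ z. (\<integral>\<^sup>+ \<omega>. (\<integral>\<^sup>+ v. indicator (open_loop_interval \<omega>) v * H \<omega> \<partial>lborel) \<partial>Q z) \<partial>m)
    = (\<integral>\<^sup>+ z. (\<integral>\<^sup>+ \<omega>. (\<integral>\<^sup>+ v. indicator (open_loop_interval \<omega>) v * H (loop_rotation v \<omega>) \<partial>lborel) \<partial>Q z) \<partial>m)"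
proof -
  have spQ: "space (Q z) = path_space" for z
    using Q[of z] sets_eq_imp_space_eq[of "Q z" path_algebra] by (auto simp: is_Qzz_def)
  have 1: "indicator (open_loop_interval \<omega>) v * H (concat_path (cut_path (\<omega>, v)))
      = indicator (open_loop_interval \<omega>) v * H \<omega>" if "\<omega> \<in> path_space" for \<omega> v
    using that by (auto simp: open_loop_interval_def indicator_def cut_path_def max_absorb2 concat_kill_shift)
  have 2: "indicator (open_loop_interval \<omega>) v * H (concat_path (prod.swap (cut_path (\<omega>, v))))
      = indicator (open_loop_interval \<omega>) v * H (loop_rotation v \<omega>)" if \<omega>: "\<omega> \<in> path_space" for \<omega> v
  proof (cases "v \<in> open_loop_interval \<omega>")
    case True
    then have v: "0 < v" "ennreal v < lifetime \<omega>" by (auto simp: open_loop_interval_def)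
    then have cut: "prod.swap (cut_path (\<omega>, v)) = (shift_path v \<omega>, kill_path v \<omega>)"
      by (simp add: cut_path_def max_absorb2)
    show ?thesis
    proof (cases "lifetime \<omega> = \<infinity>")
      case True
      then have "lifetime (concat_path (shift_path v \<omega>, kill_path v \<omega>)) = \<infinity>"
        using \<omega> v by (subst lifetime_concat) (auto simp: shift_path_in kill_path_in lifetime_shift)
      moreover have "loop_rotation v \<omega> = \<omega>" using True by (simp add: loop_rotation_def)
      ultimately show ?thesis using True unfolding cut by (simp add: H0)
    next
      case False
      then have "\<omega> \<in> loops" using \<omega> le_less_trans[OF zero_le v(2)] by (simp add: loops_def less_top)
      then show ?thesis unfolding cut using v by (simp add: loop_rotation_concat)
    qed
  qed simp
  have "(\<lambda>p. H (concat_path p)) \<in> borel_measurable (path_algebra \<Otimes>\<^sub>M path_algebra)"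
    by (rule measurable_compose[OF measurable_concat_path[OF state_space] H])
  note swap = cut_integral_swap[OF this]
  have "(\<integral>\<^sup>+ z. (\<integral>\<^sup>+ \<omega>. (\<integral>\<^sup>+ v. indicator (open_loop_interval \<omega>) v * H \<omega> \<partial>lborel) \<partial>Q z) \<partial>m)
      = (\<integral>\<^sup>+ z. (\<integral>\<^sup>+ \<omega>. (\<integral>\<^sup>+ v. indicator (open_loop_interval \<omega>) v * H (concat_path (cut_path (\<omega>, v))) \<partial>lborel) \<partial>Q z) \<partial>m)"
    by (rule nn_integral_cong)+ (rule 1[symmetric], simp add: spQ)
  also note swap
  also have "(\<integral>\<^sup>+ z. (\<integral>\<^sup>+ \<omega>. (\<integral>\<^sup>+ v. indicator (open_loop_interval \<omega>) v *
        H (concat_path (prod.swap (cut_path (\<omega>, v)))) \<partial>lborel) \<partial>Q z) \<partial>m)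
      = (\<integral>\<^sup>+ z. (\<integral>\<^sup>+ \<omega>. (\<integral>\<^sup>+ v. indicator (open_loop_interval \<omega>) v * H (loop_rotation v \<omega>) \<partial>lborel) \<partial>Q z) \<partial>m)"
    by (rule nn_integral_cong)+ (rule 2, simp add: spQ)
  finally show ?thesis .
qed

text \<open>
  Dividing by the square of the lifetime is suggested by \<open>F / \<zeta> = \<integral>\<^sub>0\<^sup>\<zeta> F / \<zeta>\<^sup>2 dv\<close>: the loop measure becomes an
  integral over cut loops, and the average of \<open>F\<close> over all rotations may take the place of \<open>F\<close>.
\<close>
lemma loop_measure_average:
  assumes F: "F \<in> borel_measurable path_algebra"
  shows "loop_measure m Q F = (\<integral>\<^sup>+ z. (\<integral>\<^sup>+ \<omega>. (\<integral>\<^sup>+ v. indicator (open_loop_interval \<omega>) v *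
      (F (loop_rotation v \<omega>) / (lifetime (loop_rotation v \<omega>))\<^sup>2) \<partial>lborel) \<partial>Q z) \<partial>m)"
proof -
  let ?H = "\<lambda>\<omega>. F \<omega> / (lifetime \<omega>)\<^sup>2"
  have H: "?H \<in> borel_measurable path_algebra" using F by measurable
  have H0: "?H \<omega> = 0" if "lifetime \<omega> = \<infinity>" for \<omega> using that by (simp add: ennreal_top_eq_mult_iff power2_eq_square)
  have "(\<integral>\<^sup>+ \<omega>. F \<omega> / lifetime \<omega> \<partial>Q z)
      = (\<integral>\<^sup>+ \<omega>. (\<integral>\<^sup>+ v. indicator (open_loop_interval \<omega>) v * ?H \<omega> \<partial>lborel) \<partial>Q z)" for z
  proof (rule nn_integral_cong_AE)
    have "AE \<omega> in Q z. 0 < lifetime \<omega>" using Q[of z] by (auto simp: is_Qzz_def)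
    then show "AE \<omega> in Q z. F \<omega> / lifetime \<omega>
        = (\<integral>\<^sup>+ v. indicator (open_loop_interval \<omega>) v * ?H \<omega> \<partial>lborel)"
    proof eventually_elim
      case (elim \<omega>)
      show ?case
      proof (cases "lifetime \<omega>")
        case (real l)
        then have l: "0 < l" using elim by auto
        have "open_loop_interval \<omega> = {0<..<l}" using real by (auto simp: open_loop_interval_def ennreal_less_iff)
        then have "(\<integral>\<^sup>+ v. indicator (open_loop_interval \<omega>) v * ?H \<omega> \<partial>lborel) = ennreal l * (F \<omega> / (ennreal l)\<^sup>2)"
          using l real by (simp add: nn_integral_multc)
        also have "\<dots> = F \<omega> / ennreal l"
        proof -
          have "inverse ((ennreal l)\<^sup>2) = inverse (ennreal l) * inverse (ennreal l)"
            using l by (simp add: power2_eq_square ennreal_mult[symmetric] inverse_ennreal)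
          moreover have "ennreal l * inverse (ennreal l) = 1"
            using l by (simp add: inverse_ennreal flip: ennreal_mult)
          ultimately show ?thesis
            unfolding divide_ennreal_def by (metis mult.assoc mult.commute mult.left_neutral)
        qed
        finally show ?thesis using real by simp
      qed (simp add: H0)
    qed
  qed
  then show ?thesis unfolding loop_measure_def using rotation_average[OF H H0] by simp
qed

text \<open>
  The average over all rotations of a loop is unchanged, for each single loop, when the loop is rotated
  first, because \<open>v \<mapsto> \<rho>\<^sub>v \<omega>\<close> is periodic with the lifetime as period.
\<close>
lemma loop_measure_rotation_invariant:
  assumes F: "F \<in> borel_measurable path_algebra"
  shows "loop_measure m Q (F \<circ> loop_rotation w) = loop_measure m Q F"
proof -
  have "(\<lambda>\<omega>. loop_rotation w \<omega>) \<in> (path_algebra :: (real \<Rightarrow> 'a option) measure) \<rightarrow>\<^sub>M path_algebra"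
    by (rule measurable_loop_rotation[OF state_space]) auto
  from measurable_compose[OF this F] have Fw: "F \<circ> loop_rotation w \<in> borel_measurable path_algebra"
    by (simp add: comp_def)
  have spQ: "space (Q z) = path_space" for z
    using Q[of z] sets_eq_imp_space_eq[of "Q z" path_algebra] by (auto simp: is_Qzz_def)
  have inner: "(\<integral>\<^sup>+ v. indicator (open_loop_interval \<omega>) v *
      ((F \<circ> loop_rotation w) (loop_rotation v \<omega>) / (lifetime (loop_rotation v \<omega>))\<^sup>2) \<partial>lborel)
    = (\<integral>\<^sup>+ v. indicator (open_loop_interval \<omega>) v *
      (F (loop_rotation v \<omega>) / (lifetime (loop_rotation v \<omega>))\<^sup>2) \<partial>lborel)" if \<omega>: "\<omega> \<in> path_space" for \<omega>
  proof (cases "\<omega> \<in> loops")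
    case True
    obtain l where l: "0 < l" "lifetime \<omega> = ennreal l" using loops_lifetime[OF True] .
    let ?g = "\<lambda>v. F (loop_rotation v \<omega>) / (lifetime \<omega>)\<^sup>2"
    have "(\<lambda>v. loop_rotation v \<omega>) \<in> borel \<rightarrow>\<^sub>M path_algebra"
      by (rule measurable_loop_rotation[OF state_space]) (use \<omega> in auto)
    from measurable_compose[OF this F] have g: "?g \<in> borel_measurable borel" by measurable
    have I: "open_loop_interval \<omega> = {0<..<l}" using l by (auto simp: open_loop_interval_def ennreal_less_iff)
    have "(\<integral>\<^sup>+ v. indicator {0<..<l} v * ?g (w + v) \<partial>lborel) = (\<integral>\<^sup>+ v. indicator {0<..<l} v * ?g v \<partial>lborel)"
      by (rule nn_integral_periodic_translate[OF g l(1)]) (simp add: loop_rotation_rmod[OF True l(2,1), symmetric])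
    then show ?thesis
      using True by (simp add: I loop_rotation_add lifetime_loop_rotation)
  next
    case False
    then consider "lifetime \<omega> = 0" | "lifetime \<omega> = \<infinity>" using \<omega>
      by (auto simp: loops_def top.not_eq_extremum[symmetric] zero_less_iff_neq_zero)
    then show ?thesis
    proof cases
      case 1 then show ?thesis by (simp add: open_loop_interval_def)
    next
      case 2
      then have "loop_rotation v \<omega> = \<omega>" for v by (simp add: loop_rotation_def)
      then show ?thesis by simp
    qed
  qed
  show ?thesis
    unfolding loop_measure_average[OF Fw] loop_measure_average[OF F]
    by (rule nn_integral_cong, rule nn_integral_cong, rule inner) (simp add: spQ)
qed

end

end

theorem theorem1p3:
  fixes P :: "real \<Rightarrow> 'a::{second_countable_topology, t2_space} \<Rightarrow> 'a measure"
    and Px :: "'a \<Rightarrow> (real \<Rightarrow> 'a option) measure"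
    and m :: "'a measure"
    and u :: "real \<Rightarrow> 'a \<Rightarrow> 'a \<Rightarrow> ennreal"
    and Q :: "'a \<Rightarrow> (real \<Rightarrow> 'a option) measure"
    and F :: "(real \<Rightarrow> 'a option) \<Rightarrow> ennreal"
    and v :: real
  assumes "loop_setting P Px m u"
    and "\<And>z. is_Qzz P u z (Q z)"
    and "0 \<le> v"
    and "F \<in> borel_measurable path_algebra"
  shows "loop_measure m Q (F \<circ> loop_rotation v) = loop_measure m Q F"
  by (rule loop_setting.loop_measure_rotation_invariant[OF assms(1,2,4)])

end
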